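(* Fix constants $h,c,\mu,\gamma>0$ with $h/\gamma>c/\mu$. For $\lambda>0$ and $s\in\mathbb{Z}_+$ let $\mathbb{E}Q_\lambda(s)$ be the expected steady-state queue length (number waiting) in the $M/M/s+M$ queue with arrival rate $\lambda$, service rate $\mu$ and exponential patience times of mean $1/\gamma$, let $\Pi_\lambda(s)=h\,\mathbb{E}Q_\lambda(s)+c\,s$, and let $\Pi_\lambda^\star=\min_{s\in\mathbb{Z}_+}\Pi_\lambda(s)$. Let $$q(\sigma)=\frac{\mu}{\gamma}\left(\sqrt{\frac{\gamma}{\mu}}\,H\!\left(\sigma\sqrt{\mu/\gamma}\right)-\sigma\right)\left(1+\sqrt{\frac{\gamma}{\mu}}\,\frac{H(\sigma\sqrt{\mu/\gamma})}{H(-\sigma)}\right)^{-1},\qquad \sigma\in\mathbb{R},$$ where $H(x)=\phi(x)/(1-\Phi(x))$ and $\phi,\Phi$ are the standard normal density and distribution function, and let $\sigma^\star$ solve $\min_{\sigma\in\mathbb{R}}\; h\,q(\sigma)+c\,\sigma$. Then the square-root staffing level $\bar s_\lambda=\frac{\lambda}{\mu}+\sigma^\star\sqrt{\frac{\lambda}{\mu}}$, rounded to an adjacent integer (either $\lfloor\bar s_\lambda\rfloor$ or $\lceil\bar s_\lambda\rceil$, denoted $s_\lambda$), is $o(1)$-optimal: $$\lim_{\lambda\to\infty}\left(\Pi_\lambda(s_\lambda)-\Pi_\lambda^\star\right)=0.$$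
   Context: $M/M/s+M$ queue: Poisson arrivals of rate $\lambda$, $s$ identical servers with exponential service times of mean $1/\mu$, and each customer has an independent exponential patience time of mean $1/\gamma$; a customer whose patience expires while waiting (before beginning service) leaves the system. Equivalently, the number in system is a birth-death process with birth rate $\lambda$ and death rate $\min(k,s)\mu+\max(k-s,0)\gamma$ in state $k$; the queue length is $\max(k-s,0)$. *)

theory Defs
  imports "HOL-Probability.Probability"
begin

section \<open>Birth-death processes and their steady state\<close>

definition bd_generator :: "(nat \<Rightarrow> real) \<Rightarrow> (nat \<Rightarrow> real) \<Rightarrow> nat \<Rightarrow> nat \<Rightarrow> real" where
  "bd_generator birth death i j =
     (if j = Suc i then birth i
      else if i = Suc j then death i
      else if i = j then - (birth i + death i)
      else 0)"

text \<open>Global balance: the row vector \<open>p\<close> satisfies \<open>p G = 0\<close>.\<close>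

definition stationary_pmf :: "(nat \<Rightarrow> nat \<Rightarrow> real) \<Rightarrow> nat pmf \<Rightarrow> bool" where
  "stationary_pmf G p \<longleftrightarrow> (\<forall>j. (\<lambda>i. pmf p i * G i j) sums 0)"

section \<open>The queue \<open>M/M/s+M\<close>\<close>

text \<open>Natural-number subtraction truncates, so \<open>k - s\<close> is \<open>max (k - s) 0\<close>.\<close>

definition queue_length :: "nat \<Rightarrow> nat \<Rightarrow> nat" where
  "queue_length s k = k - s"

definition departure_rate :: "real \<Rightarrow> real \<Rightarrow> nat \<Rightarrow> nat \<Rightarrow> real" where
  "departure_rate \<mu> \<gamma> s k = real (min k s) * \<mu> + real (queue_length s k) * \<gamma>"

definition erlang_a_generator :: "real \<Rightarrow> real \<Rightarrow> real \<Rightarrow> nat \<Rightarrow> nat \<Rightarrow> nat \<Rightarrow> real" where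
  "erlang_a_generator lam \<mu> \<gamma> s = bd_generator (\<lambda>_. lam) (departure_rate \<mu> \<gamma> s)"

text \<open>For positive rates the description below is proper: see \<open>ex1_stationary\<close> and
  \<open>integrable_queue_length\<close>.\<close>

definition steady_state :: "real \<Rightarrow> real \<Rightarrow> real \<Rightarrow> nat \<Rightarrow> nat pmf" where
  "steady_state lam \<mu> \<gamma> s = (THE p. stationary_pmf (erlang_a_generator lam \<mu> \<gamma> s) p)"

definition mean_queue :: "real \<Rightarrow> real \<Rightarrow> real \<Rightarrow> nat \<Rightarrow> real" where
  "mean_queue lam \<mu> \<gamma> s =
     measure_pmf.expectation (steady_state lam \<mu> \<gamma> s) (\<lambda>k. real (queue_length s k))"

definition staffing_cost :: "real \<Rightarrow> real \<Rightarrow> real \<Rightarrow> real \<Rightarrow> real \<Rightarrow> nat \<Rightarrow> real" where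
  "staffing_cost h c \<mu> \<gamma> lam s = h * mean_queue lam \<mu> \<gamma> s + c * real s"

text \<open>A genuine minimum over all staffing levels (zero included), attained by
  \<open>min_cost_attained\<close>.\<close>

definition min_cost :: "real \<Rightarrow> real \<Rightarrow> real \<Rightarrow> real \<Rightarrow> real \<Rightarrow> real" where
  "min_cost h c \<mu> \<gamma> lam = (LEAST x. x \<in> range (staffing_cost h c \<mu> \<gamma> lam))"

section \<open>The diffusion-scale staffing problem\<close>

definition normal_hazard :: "real \<Rightarrow> real" where
  "normal_hazard x = std_normal_density x / (1 - cdf std_normal_distribution x)"

definition diffusion_queue :: "real \<Rightarrow> real \<Rightarrow> real \<Rightarrow> real" where
  "diffusion_queue \<mu> \<gamma> \<sigma> =
     \<mu> / \<gamma> * (sqrt (\<gamma> / \<mu>) * normal_hazard (\<sigma> * sqrt (\<mu> / \<gamma>)) - \<sigma>) *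
     inverse (1 + sqrt (\<gamma> / \<mu>) * (normal_hazard (\<sigma> * sqrt (\<mu> / \<gamma>)) / normal_hazard (- \<sigma>)))"

definition diffusion_cost :: "real \<Rightarrow> real \<Rightarrow> real \<Rightarrow> real \<Rightarrow> real \<Rightarrow> real" where
  "diffusion_cost h c \<mu> \<gamma> \<sigma> = h * diffusion_queue \<mu> \<gamma> \<sigma> + c * \<sigma>"

definition sqrt_staffing :: "real \<Rightarrow> real \<Rightarrow> real \<Rightarrow> real" where
  "sqrt_staffing \<mu> \<sigma> lam = lam / \<mu> + \<sigma> * sqrt (lam / \<mu>)"

section \<open>The definitions are proper\<close>

lemma departure_rate_0: "departure_rate \<mu> \<gamma> s 0 = 0"
  by (simp add: departure_rate_def queue_length_def)

lemma departure_rate_ge: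
  assumes "0 < \<mu>" "0 < \<gamma>"
  shows "real k * min \<mu> \<gamma> \<le> departure_rate \<mu> \<gamma> s k"
proof -
  have "real k = real (min k s) + real (k - s)"
    by (simp add: min_def)
  then have "real k * min \<mu> \<gamma> = real (min k s) * min \<mu> \<gamma> + real (k - s) * min \<mu> \<gamma>"
    by (metis distrib_right)
  also have "\<dots> \<le> real (min k s) * \<mu> + real (k - s) * \<gamma>"
    by (intro add_mono mult_left_mono) auto
  finally show ?thesis
    by (simp add: departure_rate_def queue_length_def)
qed

lemma departure_rate_pos:
  assumes "0 < \<mu>" "0 < \<gamma>" "0 < k"
  shows "0 < departure_rate \<mu> \<gamma> s k"
proof -
  have "0 < real k * min \<mu> \<gamma>" using assms by simp
  then show ?thesis using departure_rate_ge[OF assms(1,2), of k s] by linarith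
qed

lemma bd_balance_iff:
  assumes "death 0 = 0"
  shows "(\<forall>j. (\<lambda>i. p i * bd_generator birth death i j) sums 0) \<longleftrightarrow>
         (\<forall>k. p (Suc k) * death (Suc k) = p k * birth k)"
proof -
  let ?G = "bd_generator birth death"
  have s0: "(\<lambda>i. p i * ?G i 0) sums (p 1 * death 1 - p 0 * birth 0)"
  proof -
    have "(\<lambda>i. p i * ?G i 0) sums (\<Sum>i\<in>{0,1}. p i * ?G i 0)"
      by (rule sums_finite) (auto simp: bd_generator_def)
    then show ?thesis by (simp add: bd_generator_def assms algebra_simps)
  qed
  have sS: "(\<lambda>i. p i * ?G i (Suc j)) sums
      (p j * birth j - p (Suc j) * (birth (Suc j) + death (Suc j))
        + p (Suc (Suc j)) * death (Suc (Suc j)))" for j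
  proof -
    have "(\<lambda>i. p i * ?G i (Suc j)) sums (\<Sum>i\<in>{j, Suc j, Suc (Suc j)}. p i * ?G i (Suc j))"
      by (rule sums_finite) (auto simp: bd_generator_def)
    then show ?thesis by (simp add: bd_generator_def algebra_simps)
  qed
  show ?thesis
  proof
    assume *: "\<forall>j. (\<lambda>i. p i * ?G i j) sums 0"
    have "p (Suc k) * death (Suc k) = p k * birth k" for k
    proof (induction k)
      case 0
      then show ?case using sums_unique2[OF s0 *[rule_format]] by simp
    next
      case (Suc k)
      then show ?case
        using sums_unique2[OF sS[of k] *[rule_format]] by (simp add: algebra_simps)
    qed
    then show "\<forall>k. p (Suc k) * death (Suc k) = p k * birth k" by blast
  next
    assume *: "\<forall>k. p (Suc k) * death (Suc k) = p k * birth k"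
    show "\<forall>j. (\<lambda>i. p i * ?G i j) sums 0"
    proof
      fix j
      show "(\<lambda>i. p i * ?G i j) sums 0"
      proof (cases j)
        case 0
        then show ?thesis using s0 *[rule_format, of 0] by simp
      next
        case (Suc k)
        then show ?thesis
          using sS[of k] *[rule_format, of k] *[rule_format, of "Suc k"]
          by (simp add: algebra_simps)
      qed
    qed
  qed
qed

definition erlang_a_weight :: "real \<Rightarrow> real \<Rightarrow> real \<Rightarrow> nat \<Rightarrow> nat \<Rightarrow> real" where
  "erlang_a_weight lam \<mu> \<gamma> s k = (\<Prod>i<k. lam / departure_rate \<mu> \<gamma> s (Suc i))"

lemma stationary_pmf_iff:
  assumes "0 < lam" "0 < \<mu>" "0 < \<gamma>"
  shows "stationary_pmf (erlang_a_generator lam \<mu> \<gamma> s) p \<longleftrightarrow>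
         (\<forall>k. pmf p k = pmf p 0 * erlang_a_weight lam \<mu> \<gamma> s k)"
proof -
  let ?d = "departure_rate \<mu> \<gamma> s"
  have d: "0 < ?d (Suc k)" for k
    using departure_rate_pos[OF assms(2,3)] by simp
  have "stationary_pmf (erlang_a_generator lam \<mu> \<gamma> s) p \<longleftrightarrow>
      (\<forall>k. pmf p (Suc k) * ?d (Suc k) = pmf p k * lam)"
    unfolding stationary_pmf_def erlang_a_generator_def
    by (rule bd_balance_iff) (rule departure_rate_0)
  also have "\<dots> \<longleftrightarrow> (\<forall>k. pmf p (Suc k) = pmf p k * (lam / ?d (Suc k)))"
  proof -
    have "pmf p (Suc k) * ?d (Suc k) = pmf p k * lam \<longleftrightarrow>
          pmf p (Suc k) = pmf p k * (lam / ?d (Suc k))" for k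
      using d[of k] by (auto simp: nonzero_eq_divide_eq)
    then show ?thesis by blast
  qed
  also have "\<dots> \<longleftrightarrow> (\<forall>k. pmf p k = pmf p 0 * erlang_a_weight lam \<mu> \<gamma> s k)"
  proof
    assume *: "\<forall>k. pmf p (Suc k) = pmf p k * (lam / ?d (Suc k))"
    show "\<forall>k. pmf p k = pmf p 0 * erlang_a_weight lam \<mu> \<gamma> s k"
    proof
      fix k
      show "pmf p k = pmf p 0 * erlang_a_weight lam \<mu> \<gamma> s k"
      proof (induction k)
        case 0
        then show ?case by (simp add: erlang_a_weight_def)
      next
        case (Suc k)
        have "pmf p (Suc k) = pmf p k * (lam / ?d (Suc k))" using * by blast
        also have "\<dots> = pmf p 0 * erlang_a_weight lam \<mu> \<gamma> s k * (lam / ?d (Suc k))"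
          using Suc by simp
        finally show ?case by (simp add: erlang_a_weight_def)
      qed
    qed
  next
    assume *: "\<forall>k. pmf p k = pmf p 0 * erlang_a_weight lam \<mu> \<gamma> s k"
    show "\<forall>k. pmf p (Suc k) = pmf p k * (lam / ?d (Suc k))"
    proof
      fix k
      have "pmf p (Suc k) = pmf p 0 * erlang_a_weight lam \<mu> \<gamma> s (Suc k)" using * by blast
      also have "\<dots> = pmf p 0 * erlang_a_weight lam \<mu> \<gamma> s k * (lam / ?d (Suc k))"
        by (simp add: erlang_a_weight_def)
      also have "\<dots> = pmf p k * (lam / ?d (Suc k))"
        by (simp only: *[rule_format, of k])
      finally show "pmf p (Suc k) = pmf p k * (lam / ?d (Suc k))" .
    qed
  qed
  finally show ?thesis .
qed

lemma erlang_a_weight_pos: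
  assumes "0 < lam" "0 < \<mu>" "0 < \<gamma>"
  shows "0 < erlang_a_weight lam \<mu> \<gamma> s k"
  unfolding erlang_a_weight_def
  using assms departure_rate_pos[OF assms(2,3)] by (intro prod_pos) simp

lemma erlang_a_weight_le:
  assumes "0 < lam" "0 < \<mu>" "0 < \<gamma>"
  shows "erlang_a_weight lam \<mu> \<gamma> s k \<le> inverse (fact k) * (lam / min \<mu> \<gamma>) ^ k"
proof (induction k)
  case 0
  then show ?case by (simp add: erlang_a_weight_def)
next
  case (Suc k)
  let ?m = "min \<mu> \<gamma>" and ?d = "departure_rate \<mu> \<gamma> s (Suc k)"
  have m: "0 < ?m" using assms by simp
  have "0 < real (Suc k) * ?m" using m by simp
  then have q: "lam / ?d \<le> lam / (real (Suc k) * ?m)"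
    using departure_rate_ge[OF assms(2,3), of "Suc k" s] assms(1)
    by (intro divide_left_mono) auto
  have "erlang_a_weight lam \<mu> \<gamma> s (Suc k) = erlang_a_weight lam \<mu> \<gamma> s k * (lam / ?d)"
    by (simp add: erlang_a_weight_def)
  also have "\<dots> \<le> inverse (fact k) * (lam / ?m) ^ k * (lam / (real (Suc k) * ?m))"
    using Suc q assms m departure_rate_pos[OF assms(2,3), of "Suc k" s]
    by (intro mult_mono) (auto simp: less_imp_le)
  also have "\<dots> = inverse (fact (Suc k)) * (lam / ?m) ^ Suc k"
    by (simp add: field_simps del: of_nat_Suc)
  finally show ?case .
qed

lemma summable_erlang_a_weight:
  assumes "0 < lam" "0 < \<mu>" "0 < \<gamma>"
  shows "summable (erlang_a_weight lam \<mu> \<gamma> s)"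
    and "summable (\<lambda>k. real k * erlang_a_weight lam \<mu> \<gamma> s k)"
proof -
  define x where "x = lam / min \<mu> \<gamma>"
  have le: "erlang_a_weight lam \<mu> \<gamma> s k \<le> inverse (fact k) * x ^ k" for k
    unfolding x_def by (rule erlang_a_weight_le[OF assms])
  note pos = erlang_a_weight_pos[OF assms, of s]
  show "summable (erlang_a_weight lam \<mu> \<gamma> s)"
    by (rule summable_comparison_test'[OF summable_exp[of x], of 0])
       (use le pos in \<open>auto simp: less_imp_le\<close>)
  have sm: "summable (\<lambda>k. real k * (inverse (fact k) * x ^ k))"
  proof -
    have "real (Suc k) * (inverse (fact (Suc k)) * x ^ Suc k) = x * (inverse (fact k) * x ^ k)" for k
      by (simp add: field_simps del: of_nat_Suc)
    then have "summable (\<lambda>k. real (Suc k) * (inverse (fact (Suc k)) * x ^ Suc k))"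
      using summable_mult[OF summable_exp[of x], of x] by (simp only:)
    then show ?thesis by (subst summable_Suc_iff[symmetric])
  qed
  show "summable (\<lambda>k. real k * erlang_a_weight lam \<mu> \<gamma> s k)"
  proof (rule summable_comparison_test'[OF sm, of 0])
    fix k :: nat
    show "norm (real k * erlang_a_weight lam \<mu> \<gamma> s k) \<le> real k * (inverse (fact k) * x ^ k)"
      using le[of k] pos[of k] by (simp add: abs_mult mult_left_mono)
  qed
qed

lemma ex1_stationary:
  assumes "0 < lam" "0 < \<mu>" "0 < \<gamma>"
  shows "\<exists>!p. stationary_pmf (erlang_a_generator lam \<mu> \<gamma> s) p"
proof -
  let ?w = "erlang_a_weight lam \<mu> \<gamma> s"
  define Z where "Z = suminf ?w"
  note sm = summable_erlang_a_weight(1)[OF assms, of s]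
  note pos = erlang_a_weight_pos[OF assms, of s]
  have Z: "0 < Z" unfolding Z_def by (rule suminf_pos[OF sm pos])
  have w0: "?w 0 = 1" by (simp add: erlang_a_weight_def)
  define p where "p = embed_pmf (\<lambda>k. ?w k / Z)"
  have sZ: "(\<lambda>k. ?w k / Z) sums 1"
    using sums_divide[OF summable_sums[OF sm], of Z] Z by (simp add: Z_def)
  have nn: "0 \<le> ?w k / Z" for k using pos[of k] Z by simp
  have "(\<integral>\<^sup>+ k. ennreal (?w k / Z) \<partial>count_space UNIV) = 1"
    by (simp add: nn_integral_count_space_nat suminf_ennreal_eq[OF nn sZ])
  then have pp: "pmf p k = ?w k / Z" for k
    unfolding p_def by (intro pmf_embed_pmf nn)
  have "stationary_pmf (erlang_a_generator lam \<mu> \<gamma> s) p"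
    unfolding stationary_pmf_iff[OF assms] by (simp add: pp w0)
  moreover have "p' = p" if "stationary_pmf (erlang_a_generator lam \<mu> \<gamma> s) p'" for p'
  proof -
    have e: "pmf p' k = pmf p' 0 * ?w k" for k
      using that unfolding stationary_pmf_iff[OF assms] by blast
    have "(\<Sum>k. pmf p' k) = pmf p' 0 * Z"
      unfolding Z_def by (subst e) (rule suminf_mult[OF sm])
    moreover have "(\<lambda>k. pmf p' k) sums 1"
    proof -
      have "(\<lambda>k. measure (measure_pmf p') {k}) sums measure (measure_pmf p') (\<Union>k. {k})"
        by (rule measure_pmf.finite_measure_UNION) (auto simp: disjoint_family_on_def)
      then show ?thesis by (simp add: measure_pmf_single)
    qed
    ultimately have "pmf p' 0 * Z = 1" by (simp add: sums_iff)
    then have "pmf p' 0 = 1 / Z" using Z by (simp add: field_simps)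
    then have "pmf p' k = pmf p k" for k using e[of k] by (simp add: pp)
    then show ?thesis by (rule pmf_eqI)
  qed
  ultimately show ?thesis by blast
qed

lemma stationary_steady_state:
  assumes "0 < lam" "0 < \<mu>" "0 < \<gamma>"
  shows "stationary_pmf (erlang_a_generator lam \<mu> \<gamma> s) (steady_state lam \<mu> \<gamma> s)"
  unfolding steady_state_def by (rule theI'[OF ex1_stationary[OF assms]])

lemma integrable_queue_length:
  assumes "0 < lam" "0 < \<mu>" "0 < \<gamma>"
  shows "integrable (measure_pmf (steady_state lam \<mu> \<gamma> s)) (\<lambda>k. real (queue_length s k))"
proof -
  let ?p = "steady_state lam \<mu> \<gamma> s" and ?w = "erlang_a_weight lam \<mu> \<gamma> s"
  have e: "pmf ?p k = pmf ?p 0 * ?w k" for k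
    using stationary_steady_state[OF assms, of s] unfolding stationary_pmf_iff[OF assms] by blast
  have sm: "summable (\<lambda>k. pmf ?p k * real k)"
    using summable_mult[OF summable_erlang_a_weight(2)[OF assms, of s], of "pmf ?p 0"]
    by (subst e) (simp add: mult_ac)
  have "summable (\<lambda>k. norm (pmf ?p k * real (queue_length s k)))"
    by (rule summable_comparison_test'[OF sm, of 0])
       (auto simp: queue_length_def intro!: mult_left_mono)
  then show ?thesis
    by (simp add: measure_pmf_eq_density integrable_density integrable_count_space_nat_iff)
qed

lemma min_cost_attained:
  assumes "0 < h" "0 < c"
  shows "\<exists>s. min_cost h c \<mu> \<gamma> lam = staffing_cost h c \<mu> \<gamma> lam s \<and>
             (\<forall>s'. staffing_cost h c \<mu> \<gamma> lam s \<le> staffing_cost h c \<mu> \<gamma> lam s')"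
proof -
  let ?C = "staffing_cost h c \<mu> \<gamma> lam"
  have lower: "c * real s \<le> ?C s" for s
  proof -
    have "0 \<le> mean_queue lam \<mu> \<gamma> s"
      unfolding mean_queue_def by (rule Bochner_Integration.integral_nonneg) simp
    then show ?thesis
      unfolding staffing_cost_def using assms(1) by (intro add_increasing mult_nonneg_nonneg) auto
  qed
  obtain n :: nat where n: "?C 0 / c < real n" using reals_Archimedean2 by blast
  obtain s where s: "s \<in> {..n}" "\<And>t. t \<in> {..n} \<Longrightarrow> ?C s \<le> ?C t"
  proof -
    have "Min (?C ` {..n}) \<in> ?C ` {..n}" by (rule Min_in) auto
    then obtain s where s: "s \<in> {..n}" "Min (?C ` {..n}) = ?C s" by blast
    have "?C s \<le> ?C t" if "t \<in> {..n}" for t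
      unfolding s(2)[symmetric] by (rule Min_le) (use that in auto)
    with s(1) show thesis by (rule that)
  qed
  have "?C s \<le> ?C t" for t
  proof (cases "t \<le> n")
    case True
    then show ?thesis using s by simp
  next
    case False
    then have "?C 0 / c < real t" using n by linarith
    then have "?C 0 < c * real t" using assms(2) by (simp add: field_simps)
    then show ?thesis using lower[of t] s(2)[of 0] by simp
  qed
  note le = this
  have "min_cost h c \<mu> \<gamma> lam = ?C s"
    unfolding min_cost_def
  proof (rule Least_equality)
    show "?C s \<in> range ?C" by (rule rangeI)
    show "?C s \<le> y" if "y \<in> range ?C" for y
      using that le by (elim rangeE) metis
  qed
  with le show ?thesis by blast
qed

end

theory Submission
  imports Defs
begin

text \<open>
  Put \<open>R = lam / \<mu>\<close> and \<open>d = \<gamma> / \<mu>\<close>. Relative to the stationary weight of state \<open>s\<close>, the states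
  up to \<open>s\<close> have total weight \<open>A\<close> and the states above \<open>s\<close> total weight \<open>C\<close>, where
    \<open>A = R * (integral over y < 0 of exp (- s y) * exp (R (1 - exp (- y)) - y))\<close>,
    \<open>C = R * (integral over y > 0 of exp (- s y) * exp ((R / d) (1 - exp (- d y)) - d y))\<close>,
  and the mean queue is \<open>(R / d + (R / d - s / d) C) / (A + C)\<close> (\<open>mean_queue_eq_erlang_queue\<close>).
  So the number of servers enters only through the factor \<open>exp (- s y)\<close>: it is the natural
  parameter of an exponential family. This has two consequences.

  Shape. Integration by parts turns \<open>(A + C) * (h E Q + c s)\<close> into the integral of a function
  \<open>g\<close> against the same kernel, and \<open>g\<close> decreases on the negative half line and increases on the
  positive one; the second monotonicity is the condition \<open>c / \<mu> < h / \<gamma>\<close>. Hence, for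
  every level \<open>\<alpha>\<close>, \<open>g - \<alpha>\<close> has at most the sign pattern plus, minus, plus, and because the exponential kernel diminishes
  variation (\<open>laplace_three_points\<close>), the cost is strictly quasi-convex in \<open>s\<close>, for every arrival
  rate. The diffusion cost \<open>f\<close> has the same structure with a two-piece Gaussian kernel, so it is
  strictly quasi-convex as well and its minimiser \<open>\<sigma>_star\<close> is unique.

  Expansion. For \<open>s = R + \<sigma> * sqrt R\<close> the substitution \<open>y = u / sqrt R\<close> turns the kernels into
  Gaussian ones up to a relative error of order \<open>1 / sqrt R\<close>, and dominated convergence gives
    \<open>cost = c R + sqrt R * f \<sigma> + r + o(1)\<close>
  along every \<open>\<sigma>\<close> that converges, with \<open>r\<close> determined by the limit of \<open>\<sigma>\<close>
  (\<open>staffing_cost_expansion\<close>).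

  Conclusion. At a fixed \<open>\<sigma> \<noteq> \<sigma>_star\<close> the cost exceeds that of square-root staffing by order
  \<open>sqrt R\<close>, so quasi-convexity forces the exactly optimal level to have \<open>\<sigma>\<close> tending to
  \<open>\<sigma>_star\<close>. The constants \<open>r\<close> of the two levels then cancel, and the cost gap is at most
  \<open>sqrt R * (f \<sigma> - f \<sigma>_star) + o(1)\<close>, where \<open>\<sigma>\<close> belongs to the rounded level. Rounding moves
  \<open>\<sigma>\<close> by at most \<open>1 / sqrt R\<close>, and \<open>f\<close> has derivative 0 at its minimiser, so this vanishes.
\<close>

section \<open>Variation diminishing and quasi-convexity\<close>

lemma exp_gt_add_one:
  fixes x :: real
  assumes "x \<noteq> 0"
  shows "1 + x < exp x"
proof (cases "1 + x / 2 \<ge> 0")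
  case True
  have "1 + x < (1 + x / 2)\<^sup>2"
    using assms zero_less_power2[of x] by (simp add: power2_eq_square algebra_simps)
  also have "\<dots> \<le> (exp (x / 2))\<^sup>2"
    using True by (intro power_mono exp_ge_add_one_self)
  also have "\<dots> = exp x"
    by (simp add: power2_eq_square flip: exp_add)
  finally show ?thesis .
next
  case False
  then show ?thesis using exp_gt_zero[of x] by linarith
qed

text \<open>
  Strict convexity of \<open>exp (p y)\<close>, with denominators cleared so that exponentials of different
  rates can be added with positive coefficients.
\<close>

lemma exp_secant_less:
  fixes p a y b :: real
  assumes "a < y" "y < b" "p \<noteq> 0"
  shows "(exp (p * y) - exp (p * a)) * (b - y) < (exp (p * b) - exp (p * y)) * (y - a)"
proof -
  have tangent: "exp (p * y) * (1 + p * (t - y)) < exp (p * t)" if "t \<noteq> y" for t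
  proof -
    have "exp (p * y) * (1 + p * (t - y)) < exp (p * y) * exp (p * (t - y))"
      using that assms(3) by (intro mult_strict_left_mono exp_gt_add_one) auto
    then show ?thesis by (simp add: algebra_simps flip: exp_add)
  qed
  have "(exp (p * y) - exp (p * a)) * (b - y) < (exp (p * y) * (p * (y - a))) * (b - y)"
    using tangent[of a] assms by (intro mult_strict_right_mono) (auto simp: algebra_simps)
  also have "\<dots> = (exp (p * y) * (p * (b - y))) * (y - a)"
    by simp
  also have "\<dots> < (exp (p * b) - exp (p * y)) * (y - a)"
    using tangent[of b] assms by (intro mult_strict_right_mono) (auto simp: algebra_simps)
  finally show ?thesis .
qed

text \<open>
  After division by \<open>exp (- s3 y)\<close> the combination is a constant subtracted from a strictly
  convex function, namely a positive combination of an increasing and a decreasing exponential. The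
  coefficients are chosen so that this convex function takes the same value at \<open>x1\<close> and \<open>x2\<close>, and
  the constant is that value.
\<close>

lemma exp_combination_signs:
  fixes s1 s2 s3 x1 x2 :: real
  assumes "s1 < s3" "s3 < s2" "x1 < x2"
  obtains a1 a2 a3 where "0 < a1" "0 < a2" "0 < a3"
    "\<And>y. y < x1 \<or> x2 < y \<Longrightarrow> 0 < a1 * exp (- s1 * y) + a2 * exp (- s2 * y) - a3 * exp (- s3 * y)"
    "\<And>y. x1 < y \<Longrightarrow> y < x2 \<Longrightarrow> a1 * exp (- s1 * y) + a2 * exp (- s2 * y) - a3 * exp (- s3 * y) < 0"
    "\<And>y. y = x1 \<or> y = x2 \<Longrightarrow> a1 * exp (- s1 * y) + a2 * exp (- s2 * y) - a3 * exp (- s3 * y) = 0"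
proof -
  define p where "p = s3 - s1"
  define r where "r = s3 - s2"
  have p: "0 < p" and r: "r < 0" using assms by (auto simp: p_def r_def)
  define a1 where "a1 = exp (r * x1) - exp (r * x2)"
  define a2 where "a2 = exp (p * x2) - exp (p * x1)"
  define F where "F y = a1 * exp (p * y) + a2 * exp (r * y)" for y
  have a1: "0 < a1" and a2: "0 < a2" using p r assms(3) by (auto simp: a1_def a2_def)
  have F12: "F x1 = F x2" by (simp add: F_def a1_def a2_def algebra_simps)
  have sec: "(F y - F a) * (b - y) < (F b - F y) * (y - a)" if "a < y" "y < b" for a b y
  proof -
    have "(F y - F a) * (b - y) = a1 * ((exp (p * y) - exp (p * a)) * (b - y))
        + a2 * ((exp (r * y) - exp (r * a)) * (b - y))"
      by (simp add: F_def algebra_simps)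
    also have "\<dots> < a1 * ((exp (p * b) - exp (p * y)) * (y - a))
        + a2 * ((exp (r * b) - exp (r * y)) * (y - a))"
      using a1 a2 p r that by (intro add_strict_mono mult_strict_left_mono exp_secant_less) auto
    also have "\<dots> = (F b - F y) * (y - a)"
      by (simp add: F_def algebra_simps)
    finally show ?thesis .
  qed
  have shift: "a1 * exp (- s1 * y) + a2 * exp (- s2 * y) - F x1 * exp (- s3 * y)
      = exp (- s3 * y) * (F y - F x1)" for y
    by (simp add: F_def p_def r_def algebra_simps flip: exp_add)
  show thesis
  proof (rule that[OF a1 a2, of "F x1"])
    show "0 < F x1" using a1 a2 unfolding F_def by (intro add_pos_pos mult_pos_pos) auto
    fix y
    show "0 < a1 * exp (- s1 * y) + a2 * exp (- s2 * y) - F x1 * exp (- s3 * y)"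
      if "y < x1 \<or> x2 < y"
      using that
    proof
      assume "y < x1"
      from sec[OF this assms(3)] have "(F x1 - F y) * (x2 - x1) < 0" by (simp add: F12)
      then have "F x1 < F y" using assms(3) by (simp add: mult_less_0_iff)
      then show ?thesis unfolding shift by simp
    next
      assume "x2 < y"
      from sec[OF assms(3) this] have "0 < (F y - F x2) * (x2 - x1)" by (simp add: F12)
      then have "F x1 < F y" using assms(3) by (simp add: zero_less_mult_iff F12)
      then show ?thesis unfolding shift by simp
    qed
    show "a1 * exp (- s1 * y) + a2 * exp (- s2 * y) - F x1 * exp (- s3 * y) < 0"
      if "x1 < y" "y < x2"
    proof -
      have "(F y - F x1) * (x2 - y) < (F x1 - F y) * (y - x1)"
        using sec[OF that] by (simp add: F12)
      then have "(F y - F x1) * (x2 - x1) < 0" by (simp add: algebra_simps)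
      then have "F y < F x1" using assms(3) by (simp add: mult_less_0_iff)
      then show ?thesis unfolding shift by (simp add: mult_less_0_iff)
    qed
    show "a1 * exp (- s1 * y) + a2 * exp (- s2 * y) - F x1 * exp (- s3 * y) = 0"
      if "y = x1 \<or> y = x2"
      using that F12 unfolding shift by auto
  qed
qed

text \<open>
  One exceptional point \<open>z\<close> is allowed because the densities of interest change their formula at
  0, where nothing is assumed about them.
\<close>

lemma integral_pos_interval:
  fixes f :: "real \<Rightarrow> real"
  assumes int: "integrable lborel f" and nn: "\<And>y. y \<noteq> z \<Longrightarrow> 0 \<le> f y"
    and ab: "a < b" and pos: "\<And>y. a < y \<Longrightarrow> y < b \<Longrightarrow> y \<noteq> z \<Longrightarrow> 0 < f y"
  shows "0 < (\<integral>y. f y \<partial>lborel)"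
proof -
  have AEz: "AE y in lborel. y \<noteq> z" by (rule AE_lborel_singleton)
  have AEnn: "AE y in lborel. 0 \<le> f y" using AEz by eventually_elim (rule nn)
  then have "0 \<le> (\<integral>y. f y \<partial>lborel)" by (rule integral_nonneg_AE)
  moreover have "(\<integral>y. f y \<partial>lborel) \<noteq> 0"
  proof
    assume "(\<integral>y. f y \<partial>lborel) = 0"
    then have "AE y in lborel. f y = 0"
      using integral_nonneg_eq_0_iff_AE[OF int AEnn] by blast
    with AEz have "AE y in lborel. y \<notin> {a<..<b}"
      by eventually_elim (use pos in force)
    then have "emeasure lborel {a<..<b} = 0"
      by (subst (asm) AE_iff_measurable[of "{a<..<b}"]) auto
    then show False using ab by simp
  qed
  ultimately show ?thesis by linarith
qed

text \<open>
  Variation diminishing for the Laplace kernel. The set where \<open>\<psi>\<close> is negative is an interval;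
  choose a combination of the three exponentials that has the same sign as \<open>\<psi>\<close> everywhere.
  Integrating the product shows that a positive combination of the values at \<open>s1\<close> and \<open>s2\<close> exceeds
  a positive multiple of the value at \<open>s3\<close>. If the interval is unbounded to the right, the
  exponential with parameter \<open>s1\<close> is left out; if it is at most a point, the value at \<open>s1\<close>
  could not be nonpositive.
\<close>

lemma laplace_three_points:
  fixes m \<psi> :: "real \<Rightarrow> real"
  assumes int: "\<And>s. s \<in> {s1, s2, s3} \<Longrightarrow> integrable lborel (\<lambda>y. \<psi> y * (exp (- s * y) * m y))"
    and m: "\<And>y. y \<noteq> 0 \<Longrightarrow> 0 < m y"
    and neg: "\<And>x y z. x < y \<Longrightarrow> y < z \<Longrightarrow> \<psi> x < 0 \<Longrightarrow> \<psi> z < 0 \<Longrightarrow> \<psi> y < 0"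
    and left: "\<And>y. y < b \<Longrightarrow> 0 < \<psi> y"
    and s: "s1 < s3" "s3 < s2"
    and le1: "(\<integral>y. \<psi> y * (exp (- s1 * y) * m y) \<partial>lborel) \<le> 0"
    and le2: "(\<integral>y. \<psi> y * (exp (- s2 * y) * m y) \<partial>lborel) \<le> 0"
  shows "(\<integral>y. \<psi> y * (exp (- s3 * y) * m y) \<partial>lborel) < 0"
proof -
  define G where "G s = (\<integral>y. \<psi> y * (exp (- s * y) * m y) \<partial>lborel)" for s
  define T where "T = {y. \<psi> y < 0}"
  let ?k = "\<lambda>a1 a2 a3 y. \<psi> y * m y * (a1 * exp (- s1 * y) + a2 * exp (- s2 * y) - a3 * exp (- s3 * y))"
  have combine: "a1 * G s1 + a2 * G s2 - a3 * G s3 = (\<integral>y. ?k a1 a2 a3 y \<partial>lborel)"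
    and int_combine: "integrable lborel (?k a1 a2 a3)" for a1 a2 a3
  proof -
    have i: "integrable lborel (\<lambda>y. a1 * (\<psi> y * (exp (- s1 * y) * m y)))"
        "integrable lborel (\<lambda>y. a2 * (\<psi> y * (exp (- s2 * y) * m y)))"
        "integrable lborel (\<lambda>y. a3 * (\<psi> y * (exp (- s3 * y) * m y)))"
      using int by (auto intro!: integrable_mult_right)
    have k: "?k a1 a2 a3 = (\<lambda>y. a1 * (\<psi> y * (exp (- s1 * y) * m y))
        + a2 * (\<psi> y * (exp (- s2 * y) * m y)) - a3 * (\<psi> y * (exp (- s3 * y) * m y)))"
      by (simp add: fun_eq_iff algebra_simps)
    show "integrable lborel (?k a1 a2 a3)" unfolding k by (intro Bochner_Integration.integrable_add Bochner_Integration.integrable_diff i)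
    show "a1 * G s1 + a2 * G s2 - a3 * G s3 = (\<integral>y. ?k a1 a2 a3 y \<partial>lborel)"
      unfolding k G_def using i by simp
  qed
  have Tlow: "b \<le> y" if "y \<in> T" for y
    using left[of y] that by (force simp: T_def not_le)
  have bdd: "bdd_below T" using Tlow by (rule bdd_belowI)
  have goal_by: "G s3 < 0" if pos: "0 < (\<integral>y. ?k a1 a2 a3 y \<partial>lborel)" and a: "0 \<le> a1" "0 \<le> a2" "0 < a3" for a1 a2 a3
  proof -
    have "0 < a1 * G s1 + a2 * G s2 - a3 * G s3" using pos combine by simp
    moreover have "a1 * G s1 \<le> 0" "a2 * G s2 \<le> 0"
      using a le1 le2 unfolding G_def by (simp_all add: mult_nonneg_nonpos)
    ultimately show ?thesis using a(3) by (smt (verit) mult_nonneg_nonneg)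
  qed
  consider z where "T \<subseteq> {z}" | u v where "u \<in> T" "v \<in> T" "u < v"
    by (metis insert_iff linorder_cases subsetI)
  then have "G s3 < 0"
  proof cases
    case (1 z)
    have nonneg: "0 \<le> \<psi> y" if "y \<noteq> z" for y using 1 that by (auto simp: T_def not_less[symmetric])
    have "AE y in lborel. 0 \<le> \<psi> y * (exp (- s1 * y) * m y)"
      using AE_lborel_singleton[of z] AE_lborel_singleton[of 0]
      by eventually_elim (use nonneg m in \<open>auto intro!: mult_nonneg_nonneg simp: less_imp_le\<close>)
    moreover have "AE y in lborel. \<psi> y * (exp (- s1 * y) * m y) = 0"
      using integral_nonneg_eq_0_iff_AE[OF int[of s1] calculation] le1 integral_nonneg_AE[OF calculation]
      by simp
    with AE_lborel_singleton[of 0] have "AE y in lborel. y \<notin> {b - 1<..<b}"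
    proof eventually_elim
      case (elim y)
      then show ?case using left[of y] m[of y] by auto
    qed
    then have "emeasure lborel {b - 1<..<b} = 0"
      by (subst (asm) AE_iff_measurable[of "{b - 1<..<b}"]) auto
    then show ?thesis by simp
  next
    case (2 u v)
    define x1 where "x1 = Inf T"
    have x1u: "x1 \<le> u" unfolding x1_def using 2 bdd by (intro cInf_lower)
    have below: "0 \<le> \<psi> y" if "y < x1" for y
      using that cInf_lower[OF _ bdd, of y] by (force simp: x1_def T_def not_less)
    have above: "\<exists>t\<in>T. t < y" if "x1 < y" for y
      using that 2 cInf_less_iff[OF _ bdd] by (auto simp: x1_def)
    show ?thesis
    proof (cases "bdd_above T")
      case True
      define x2 where "x2 = Sup T"
      have "v \<le> x2" unfolding x2_def using 2 True by (intro cSup_upper)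
      then have x12: "x1 < x2" using x1u 2 by simp
      have beyond: "0 \<le> \<psi> y" if "x2 < y" for y
        using that cSup_upper[OF _ True, of y] by (force simp: x2_def T_def not_less)
      have inside: "\<psi> y < 0" if "x1 < y" "y < x2" for y
      proof -
        obtain t where "t \<in> T" "t < y" using above \<open>x1 < y\<close> by blast
        moreover obtain t' where "t' \<in> T" "y < t'"
          using \<open>y < x2\<close> 2 less_cSup_iff[OF _ True] by (metis empty_iff x2_def)
        ultimately show ?thesis using neg[of t y t'] by (auto simp: T_def)
      qed
      obtain a1 a2 a3 where a: "0 < a1" "0 < a2" "0 < a3"
        and k: "\<And>y. y < x1 \<or> x2 < y \<Longrightarrow> 0 < a1 * exp (- s1 * y) + a2 * exp (- s2 * y) - a3 * exp (- s3 * y)"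
        "\<And>y. x1 < y \<Longrightarrow> y < x2 \<Longrightarrow> a1 * exp (- s1 * y) + a2 * exp (- s2 * y) - a3 * exp (- s3 * y) < 0"
        "\<And>y. y = x1 \<or> y = x2 \<Longrightarrow> a1 * exp (- s1 * y) + a2 * exp (- s2 * y) - a3 * exp (- s3 * y) = 0"
        using exp_combination_signs[OF s x12] by metis
      have "0 < (\<integral>y. ?k a1 a2 a3 y \<partial>lborel)"
      proof (rule integral_pos_interval[OF int_combine _ x12])
        show "0 < ?k a1 a2 a3 y" if "x1 < y" "y < x2" "y \<noteq> 0" for y
          using inside[OF that(1,2)] k(2)[OF that(1,2)] m[OF that(3)]
          by (intro mult_neg_neg mult_neg_pos)
        show "0 \<le> ?k a1 a2 a3 y" if "y \<noteq> 0" for y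
        proof -
          consider "y < x1" | "x2 < y" | "x1 < y \<and> y < x2" | "y = x1 \<or> y = x2" by linarith
          then show ?thesis
          proof cases
            case 1
            then show ?thesis using below[OF 1] k(1)[of y] m[OF that] by simp
          next
            case 2
            then show ?thesis using beyond[OF 2] k(1)[of y] m[OF that] by simp
          next
            case 3
            then show ?thesis using inside[of y] k(2)[of y] m[OF that]
              by (intro mult_nonpos_nonpos mult_nonpos_nonneg) auto
          next
            case 4
            then show ?thesis using k(3)[of y] by simp
          qed
        qed
      qed
      then show ?thesis using goal_by a by (simp add: less_imp_le)
    next
      case False
      have inside: "\<psi> y < 0" if "x1 < y" for y
      proof -
        obtain t where "t \<in> T" "t < y" using above \<open>x1 < y\<close> by blast
        moreover obtain t' where "t' \<in> T" "y < t'"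
          using False by (metis bdd_above.I not_le)
        ultimately show ?thesis using neg[of t y t'] by (auto simp: T_def)
      qed
      define a2 where "a2 = exp (s2 * x1)"
      define a3 where "a3 = exp (s3 * x1)"
      have k: "0 * exp (- s1 * y) + a2 * exp (- s2 * y) - a3 * exp (- s3 * y)
          = exp (s2 * (x1 - y)) - exp (s3 * (x1 - y))" for y
        by (simp add: a2_def a3_def algebra_simps flip: exp_add)
      have kpos: "0 < exp (s2 * (x1 - y)) - exp (s3 * (x1 - y))" if "y < x1" for y
        using that s by (simp add: mult_strict_right_mono)
      have kneg: "exp (s2 * (x1 - y)) - exp (s3 * (x1 - y)) < 0" if "x1 < y" for y
        using that s by (simp add: mult_strict_right_mono_neg)
      have "0 < (\<integral>y. ?k 0 a2 a3 y \<partial>lborel)"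
      proof (rule integral_pos_interval[OF int_combine[of 0 a2 a3], where z = 0 and a = x1 and b = "x1 + 1"])
        show pos: "0 < ?k 0 a2 a3 y" if "x1 < y" "y \<noteq> 0" for y
          unfolding k using inside[OF that(1)] kneg[OF that(1)] m[OF that(2)]
          by (intro mult_neg_neg mult_neg_pos)
        show "0 \<le> ?k 0 a2 a3 y" if "y \<noteq> 0" for y
        proof -
          consider "x1 < y" | "y < x1" | "y = x1" by linarith
          then show ?thesis
          proof cases
            case 1
            show ?thesis using pos[OF 1 that] by (rule less_imp_le)
          next
            case 2
            then show ?thesis unfolding k using below[OF 2] kpos[OF 2] m[OF that]
              by (intro mult_nonneg_nonneg) auto
          next
            case 3
            then show ?thesis unfolding k by simp
          qed
        qed
      qed simp
      then show ?thesis using goal_by[of 0 a2 a3] by (simp add: a2_def a3_def)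
    qed
  qed
  then show ?thesis by (simp add: G_def)
qed

text \<open>
  The value \<open>f s\<close> is the mean of \<open>g\<close> under the density proportional to \<open>exp (- s y) * m y\<close>.
  Monotonicity of \<open>g\<close> on each half line makes every strict sublevel set an interval, whatever
  jump \<open>g\<close> has at 0.
\<close>

lemma tilted_mean_strictly_quasiconvex:
  fixes f m g :: "real \<Rightarrow> real"
  assumes m: "\<And>y. y \<noteq> 0 \<Longrightarrow> 0 < m y"
    and s: "s1 < s3" "s3 < s2"
    and int_m: "\<And>s. s \<in> {s1, s2, s3} \<Longrightarrow> integrable lborel (\<lambda>y. exp (- s * y) * m y)"
    and int_g: "\<And>s. s \<in> {s1, s2, s3} \<Longrightarrow> integrable lborel (\<lambda>y. g y * (exp (- s * y) * m y))"
    and f: "\<And>s. s \<in> {s1, s2, s3} \<Longrightarrow>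
      f s * (\<integral>y. exp (- s * y) * m y \<partial>lborel) = (\<integral>y. g y * (exp (- s * y) * m y) \<partial>lborel)"
    and left: "\<And>x y. x < y \<Longrightarrow> y < 0 \<Longrightarrow> g y \<le> g x"
    and right: "\<And>x y. 0 \<le> x \<Longrightarrow> x < y \<Longrightarrow> g x \<le> g y"
    and top: "filterlim g at_top at_bot"
  shows "f s3 < max (f s1) (f s2)"
proof (rule ccontr)
  assume neg: "\<not> f s3 < max (f s1) (f s2)"
  define \<alpha> where "\<alpha> = max (f s1) (f s2)"
  have int: "integrable lborel (\<lambda>y. (g y - \<alpha>) * (exp (- s * y) * m y))"
    and val: "(\<integral>y. (g y - \<alpha>) * (exp (- s * y) * m y) \<partial>lborel)
      = (f s - \<alpha>) * (\<integral>y. exp (- s * y) * m y \<partial>lborel)" if "s \<in> {s1, s2, s3}" for s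
  proof -
    have e: "(\<lambda>y. (g y - \<alpha>) * (exp (- s * y) * m y)) =
        (\<lambda>y. g y * (exp (- s * y) * m y) - \<alpha> * (exp (- s * y) * m y))"
      by (simp add: fun_eq_iff algebra_simps)
    show "integrable lborel (\<lambda>y. (g y - \<alpha>) * (exp (- s * y) * m y))"
      unfolding e by (intro Bochner_Integration.integrable_diff integrable_mult_right int_g int_m that)
    show "(\<integral>y. (g y - \<alpha>) * (exp (- s * y) * m y) \<partial>lborel)
      = (f s - \<alpha>) * (\<integral>y. exp (- s * y) * m y \<partial>lborel)"
      unfolding e using f[OF that] int_g[OF that] int_m[OF that]
      by (simp add: algebra_simps)
  qed
  have Z: "0 \<le> (\<integral>y. exp (- s * y) * m y \<partial>lborel)" for s
  proof (rule integral_nonneg_AE)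
    show "AE y in lborel. 0 \<le> exp (- s * y) * m y"
      using AE_lborel_singleton[of 0] by eventually_elim (use m in \<open>simp add: less_imp_le\<close>)
  qed
  obtain b where b: "\<And>y. y < b \<Longrightarrow> \<alpha> < g y"
  proof -
    have "eventually (\<lambda>y. \<alpha> < g y) at_bot" using top by (simp add: filterlim_at_top_dense)
    then show thesis using that by (auto simp: eventually_at_bot_linorder) (meson less_imp_le)
  qed
  have "(\<integral>y. (g y - \<alpha>) * (exp (- s3 * y) * m y) \<partial>lborel) < 0"
  proof (rule laplace_three_points[where b = b, OF int m _ _ s])
    show "g y - \<alpha> < 0" if "x < y" "y < z" "g x - \<alpha> < 0" "g z - \<alpha> < 0" for x y z
      using that left[of x y] right[of y z] by (cases "y < 0") auto
    show "0 < g y - \<alpha>" if "y < b" for y using b that by simp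
    show "(\<integral>y. (g y - \<alpha>) * (exp (- s1 * y) * m y) \<partial>lborel) \<le> 0"
      using Z[of s1] by (subst val) (auto simp: \<alpha>_def intro!: mult_nonpos_nonneg)
    show "(\<integral>y. (g y - \<alpha>) * (exp (- s2 * y) * m y) \<partial>lborel) \<le> 0"
      using Z[of s2] by (subst val) (auto simp: \<alpha>_def intro!: mult_nonpos_nonneg)
  qed auto
  moreover have "0 \<le> (\<integral>y. (g y - \<alpha>) * (exp (- s3 * y) * m y) \<partial>lborel)"
    using Z[of s3] neg by (subst val) (auto simp: \<alpha>_def intro!: mult_nonneg_nonneg)
  ultimately show False by simp
qed

section \<open>Integrals over half lines\<close>

lemma integrable_exp_neg_abs:
  fixes c :: real
  assumes "0 < c"
  shows "integrable lborel (\<lambda>y. exp (- c * \<bar>y\<bar>))"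
proof -
  have tail: "integrable lborel (\<lambda>y. exp (- c * y) * indicator {0..} y)"
  proof (rule integrableI_bounded)
    have "(\<integral>\<^sup>+y. ennreal (norm (exp (- c * y) * indicator {0..} y)) \<partial>lborel)
        = (\<integral>\<^sup>+y. ennreal (exp (- c * y)) * indicator {0..} y \<partial>lborel)"
      by (intro nn_integral_cong) (simp split: split_indicator)
    also have "\<dots> = ennreal (0 - (- exp (- c * 0) / c))"
    proof (rule nn_integral_FTC_atLeast)
      show "((\<lambda>y. - exp (- c * y) / c) has_real_derivative exp (- c * y)) (at y)" for y
        using assms by (auto intro!: derivative_eq_intros)
      show "((\<lambda>y. - exp (- c * y) / c) \<longlongrightarrow> 0) at_top"
        using assms by real_asymp
    qed auto
    also have "\<dots> < \<infinity>" by simp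
    finally show "(\<integral>\<^sup>+y. ennreal (norm (exp (- c * y) * indicator {0..} y)) \<partial>lborel) < \<infinity>" .
  qed simp
  have "integrable lborel (\<lambda>y. exp (- c * (0 + (-1) * y)) * indicator {0..} (0 + (-1) * y))"
    by (rule lborel_integrable_real_affine[OF tail]) simp
  from Bochner_Integration.integrable_add[OF tail this] show ?thesis
    by (rule Bochner_Integration.integrable_bound) (auto split: split_indicator)
qed

lemma exp_ge_power_div_fact:
  fixes z :: real
  assumes "0 \<le> z"
  shows "z ^ n / fact n \<le> exp z"
proof -
  have "(\<Sum>k\<in>{n}. inverse (fact k) * z ^ k) \<le> (\<Sum>k. inverse (fact k) * z ^ k)"
    using assms by (intro sum_le_suminf summable_exp) auto
  also have "\<dots> = exp z"
    by (simp add: exp_def divide_inverse mult.commute)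
  finally show ?thesis by (simp add: divide_inverse mult.commute)
qed

lemma integral_right_half_line_FTC:
  fixes F f :: "real \<Rightarrow> real"
  assumes F: "\<And>y. (F has_real_derivative f y) (at y)" and f: "\<And>y. isCont f y"
    and int: "set_integrable lborel {0<..} f" and lim: "(F \<longlongrightarrow> 0) at_top"
  shows "(LBINT y:{0<..}. f y) = - F 0"
proof -
  have "(LBINT y=ereal 0..\<infinity>. f y) = 0 - F 0"
  proof (rule interval_integral_FTC_integrable[where F = F])
    show "(F has_vector_derivative f y) (at y)" for y
      using F by (simp add: has_real_derivative_iff_has_vector_derivative)
    show "set_integrable lborel (einterval (ereal 0) \<infinity>) f"
      using int by (simp add: einterval_def greaterThan_def)
    have "(F \<longlongrightarrow> F 0) (at_right 0)"
      using DERIV_isCont[OF F[of 0]] unfolding isCont_def by (rule tendsto_within_subset) auto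
    then show "((F \<circ> real_of_ereal) \<longlongrightarrow> F 0) (at_right (ereal 0))"
      by (simp add: ereal_tendsto_simps)
    show "((F \<circ> real_of_ereal) \<longlongrightarrow> 0) (at_left \<infinity>)"
      using lim by (simp add: ereal_tendsto_simps)
  qed (use f in auto)
  then show ?thesis
    by (simp add: interval_lebesgue_integral_def einterval_def greaterThan_def)
qed

lemma integral_left_half_line_FTC:
  fixes F f :: "real \<Rightarrow> real"
  assumes F: "\<And>y. (F has_real_derivative f y) (at y)" and f: "\<And>y. isCont f y"
    and int: "set_integrable lborel {..<0} f" and lim: "(F \<longlongrightarrow> 0) at_bot"
  shows "(LBINT y:{..<0}. f y) = F 0"
proof -
  have "(LBINT y=-\<infinity>..ereal 0. f y) = F 0 - 0"
  proof (rule interval_integral_FTC_integrable[where F = F])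
    show "(F has_vector_derivative f y) (at y)" for y
      using F by (simp add: has_real_derivative_iff_has_vector_derivative)
    show "set_integrable lborel (einterval (-\<infinity>) (ereal 0)) f"
      using int by (simp add: einterval_def lessThan_def)
    have "(F \<longlongrightarrow> F 0) (at_left 0)"
      using DERIV_isCont[OF F[of 0]] unfolding isCont_def by (rule tendsto_within_subset) auto
    then show "((F \<circ> real_of_ereal) \<longlongrightarrow> F 0) (at_left (ereal 0))"
      by (simp add: ereal_tendsto_simps)
    show "((F \<circ> real_of_ereal) \<longlongrightarrow> 0) (at_right (-\<infinity>))"
      using lim by (simp add: ereal_tendsto_simps)
  qed (use f in auto)
  then show ?thesis
    by (simp add: interval_lebesgue_integral_def einterval_def lessThan_def)
qed

lemma integral_split_at_zero:
  fixes F f g :: "real \<Rightarrow> real"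
  assumes f: "set_integrable lborel {..<0} f" and g: "set_integrable lborel {0<..} g"
    and F: "\<And>y. y < 0 \<Longrightarrow> F y = f y" "\<And>y. 0 < y \<Longrightarrow> F y = g y"
    and meas: "F \<in> borel_measurable borel"
  shows "integrable lborel F"
    and "(\<integral>y. F y \<partial>lborel) = (LBINT y:{..<0}. f y) + (LBINT y:{0<..}. g y)"
proof -
  let ?H = "\<lambda>y. indicator {..<0} y *\<^sub>R f y + indicator {0<..} y *\<^sub>R g y"
  have H: "integrable lborel ?H" "(\<integral>y. ?H y \<partial>lborel) = (LBINT y:{..<0}. f y) + (LBINT y:{0<..}. g y)"
    using f g unfolding set_integrable_def set_lebesgue_integral_def by auto
  have ae: "AE y in lborel. F y = ?H y"
    using AE_lborel_singleton[of 0]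
    by eventually_elim (use F in \<open>auto split: split_indicator simp: not_less\<close>)
  show "integrable lborel F"
    using integrable_cong_AE[OF _ _ ae] meas H(1) borel_measurable_integrable[OF H(1)] by simp
  show "(\<integral>y. F y \<partial>lborel) = (LBINT y:{..<0}. f y) + (LBINT y:{0<..}. g y)"
    using integral_cong_AE[OF _ _ ae] meas H borel_measurable_integrable[OF H(1)] by simp
qed

section \<open>The exponential family behind the queue\<close>

text \<open>
  Up to the factor \<open>R * exp (- p y)\<close>, this is the integrand of both weight sums, with \<open>d = 1\<close> for the
  states up to the number of servers and \<open>d = \<gamma> / \<mu>\<close> above. It satisfies
  \<open>R * erlang_kernel R d y = E' y\<close> for \<open>E y = exp (R / d * (1 - exp (- d y)))\<close>.
\<close>

definition erlang_kernel :: "real \<Rightarrow> real \<Rightarrow> real \<Rightarrow> real" where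
  "erlang_kernel R d y = exp (R / d * (1 - exp (- d * y)) - d * y)"

definition busy_transform :: "real \<Rightarrow> real \<Rightarrow> real" where
  "busy_transform R p = (LBINT y:{..<0}. exp (- p * y) * erlang_kernel R 1 y)"

definition wait_transform :: "real \<Rightarrow> real \<Rightarrow> real \<Rightarrow> real" where
  "wait_transform R d p = (LBINT y:{0<..}. exp (- p * y) * erlang_kernel R d y)"

lemma erlang_kernel_pos: "0 < erlang_kernel R d y"
  by (simp add: erlang_kernel_def)

lemma erlang_kernel_measurable [measurable]: "erlang_kernel R d \<in> borel_measurable borel"
  unfolding erlang_kernel_def by measurable

text \<open>
  Tilting by \<open>p + d\<close> instead of \<open>p\<close> multiplies the kernel by \<open>exp (- d y)\<close>, so this derivative
  involves only two tilted kernels. Both recurrences below are its integral over a half line.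
\<close>

lemma erlang_kernel_DERIV:
  assumes "d \<noteq> 0"
  shows "((\<lambda>y. exp (- p * y) * erlang_kernel R d y) has_real_derivative
    R * (exp (- (p + d) * y) * erlang_kernel R d y) - (p + d) * (exp (- p * y) * erlang_kernel R d y)) (at y)"
  unfolding erlang_kernel_def using assms
  by (auto intro!: derivative_eq_intros simp: algebra_simps simp flip: exp_add)

lemma erlang_kernel_right_le:
  assumes "0 < R" "0 < d" "0 \<le> p" "0 \<le> y"
  shows "exp (- p * y) * erlang_kernel R d y \<le> exp (R / d) * exp (- d * y)"
proof -
  have "R / d * (1 - exp (- d * y)) \<le> R / d * 1"
    using assms by (intro mult_left_mono) auto
  moreover have "0 \<le> p * y" using assms by simp
  ultimately show ?thesis
    unfolding erlang_kernel_def by (simp flip: exp_add)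
qed

text \<open>
  On the negative half line the kernel decays doubly exponentially, which beats any tilt: the
  exponential series bounds \<open>exp (- R exp (- y))\<close> by an arbitrary power of \<open>exp y\<close>.
\<close>

lemma erlang_kernel_left_le:
  assumes "0 < R"
  shows "\<exists>C>0. \<forall>y\<le>0. exp (- p * y) * erlang_kernel R 1 y \<le> C * exp y"
proof -
  obtain n :: nat where n: "p + 2 \<le> real n" using real_arch_simple by blast
  define C where "C = exp R * (fact n / R ^ n)"
  have Cpos: "0 < C" using assms by (simp add: C_def)
  have "exp (- p * y) * erlang_kernel R 1 y \<le> C * exp y" if "y \<le> 0" for y
  proof -
    have "(R * exp (- y)) ^ n / fact n \<le> exp (R * exp (- y))"
      using assms by (intro exp_ge_power_div_fact) auto
    then have "1 / exp (R * exp (- y)) \<le> 1 / ((R * exp (- y)) ^ n / fact n)"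
      using assms by (intro divide_left_mono) auto
    then have le: "exp (- (R * exp (- y))) \<le> fact n / R ^ n * exp (real n * y)"
      using assms by (simp add: exp_minus field_simps power_mult_distrib exp_of_nat_mult exp_of_nat2_mult flip: power_inverse)
    have "exp (- p * y) * erlang_kernel R 1 y = exp (- (p + 1) * y) * exp R * exp (- (R * exp (- y)))"
      unfolding erlang_kernel_def by (simp add: algebra_simps flip: exp_add)
    also have "\<dots> \<le> exp (- (p + 1) * y) * exp R * (fact n / R ^ n * exp (real n * y))"
      by (intro mult_left_mono le) auto
    also have "\<dots> = C * exp ((real n - p - 1) * y)"
      unfolding C_def by (simp add: algebra_simps flip: exp_add)
    also have "\<dots> \<le> C * exp y"
    proof -
      have "(real n - p - 1) * y \<le> 1 * y"
        using n that by (intro mult_right_mono_neg) auto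
      then show ?thesis using Cpos by (intro mult_left_mono) auto
    qed
    finally show ?thesis .
  qed
  with Cpos show ?thesis by blast
qed

lemma wait_transform_integrable:
  assumes "0 < R" "0 < d" "0 \<le> p"
  shows "set_integrable lborel {0<..} (\<lambda>y. exp (- p * y) * erlang_kernel R d y)"
  unfolding set_integrable_def
proof (rule Bochner_Integration.integrable_bound)
  show "integrable lborel (\<lambda>y. exp (R / d) * exp (- d * \<bar>y\<bar>))"
    by (intro integrable_mult_right integrable_exp_neg_abs assms)
  show "AE y in lborel. norm (indicator {0<..} y *\<^sub>R (exp (- p * y) * erlang_kernel R d y))
      \<le> norm (exp (R / d) * exp (- d * \<bar>y\<bar>))"
    using erlang_kernel_right_le[OF assms] erlang_kernel_pos
    by (intro AE_I2) (auto split: split_indicator simp: abs_mult less_imp_le)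
qed measurable

lemma busy_transform_integrable:
  assumes "0 < R"
  shows "set_integrable lborel {..<0} (\<lambda>y. exp (- p * y) * erlang_kernel R 1 y)"
proof -
  obtain C where C: "C > 0" "\<And>y. y \<le> 0 \<Longrightarrow> exp (- p * y) * erlang_kernel R 1 y \<le> C * exp y"
    using erlang_kernel_left_le[OF assms] by blast
  show ?thesis
    unfolding set_integrable_def
  proof (rule Bochner_Integration.integrable_bound)
    show "integrable lborel (\<lambda>y. C * exp (- 1 * \<bar>y\<bar>))"
      by (intro integrable_mult_right integrable_exp_neg_abs) auto
    show "AE y in lborel. norm (indicator {..<0} y *\<^sub>R (exp (- p * y) * erlang_kernel R 1 y))
        \<le> norm (C * exp (- 1 * \<bar>y\<bar>))"
      using C erlang_kernel_pos
      by (intro AE_I2) (auto split: split_indicator simp: abs_mult less_imp_le)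
  qed measurable
qed

lemma wait_transform_recurrence:
  assumes "0 < R" "0 < d" "0 \<le> p"
  shows "R * wait_transform R d (p + d) = (p + d) * wait_transform R d p - 1"
proof -
  let ?F = "\<lambda>p y. exp (- p * y) * erlang_kernel R d y"
  have int: "set_integrable lborel {0<..} (?F p)" "set_integrable lborel {0<..} (?F (p + d))"
    using assms by (intro wait_transform_integrable; simp)+
  have "(LBINT y:{0<..}. R * ?F (p + d) y - (p + d) * ?F p y) = - ?F p 0"
  proof (rule integral_right_half_line_FTC)
    show "(?F p has_real_derivative R * ?F (p + d) y - (p + d) * ?F p y) (at y)" for y
      using assms by (intro erlang_kernel_DERIV) auto
    show "isCont (\<lambda>y. R * ?F (p + d) y - (p + d) * ?F p y) y" for y
      unfolding erlang_kernel_def by (intro continuous_intros) (use assms in auto)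
    show "set_integrable lborel {0<..} (\<lambda>y. R * ?F (p + d) y - (p + d) * ?F p y)"
      using int by (intro set_integral_diff) auto
    show "(?F p \<longlongrightarrow> 0) at_top"
    proof (rule tendsto_sandwich)
      show "eventually (\<lambda>y. 0 \<le> ?F p y) at_top"
        using erlang_kernel_pos by (auto simp: less_imp_le)
      show "eventually (\<lambda>y. ?F p y \<le> exp (R / d) * exp (- d * y)) at_top"
        using eventually_ge_at_top[of 0] by eventually_elim (rule erlang_kernel_right_le[OF assms])
      show "((\<lambda>y. exp (R / d) * exp (- d * y)) \<longlongrightarrow> 0) at_top"
        using assms by real_asymp
    qed simp
  qed
  moreover have "(LBINT y:{0<..}. R * ?F (p + d) y - (p + d) * ?F p y)
      = R * wait_transform R d (p + d) - (p + d) * wait_transform R d p"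
    unfolding wait_transform_def using int by (subst set_integral_diff) auto
  ultimately show ?thesis by (simp add: erlang_kernel_def)
qed

lemma busy_transform_recurrence:
  assumes "0 < R"
  shows "R * busy_transform R (p + 1) = (p + 1) * busy_transform R p + 1"
proof -
  let ?F = "\<lambda>p y. exp (- p * y) * erlang_kernel R 1 y"
  have int: "set_integrable lborel {..<0} (?F p)" "set_integrable lborel {..<0} (?F (p + 1))"
    by (intro busy_transform_integrable assms)+
  obtain C where C: "C > 0" "\<And>y. y \<le> 0 \<Longrightarrow> ?F p y \<le> C * exp y"
    using erlang_kernel_left_le[OF assms] by blast
  have "(LBINT y:{..<0}. R * ?F (p + 1) y - (p + 1) * ?F p y) = ?F p 0"
  proof (rule integral_left_half_line_FTC)
    show "(?F p has_real_derivative R * ?F (p + 1) y - (p + 1) * ?F p y) (at y)" for y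
      by (intro erlang_kernel_DERIV) auto
    show "isCont (\<lambda>y. R * ?F (p + 1) y - (p + 1) * ?F p y) y" for y
      unfolding erlang_kernel_def by (intro continuous_intros) auto
    show "set_integrable lborel {..<0} (\<lambda>y. R * ?F (p + 1) y - (p + 1) * ?F p y)"
      using int by (intro set_integral_diff) auto
    show "(?F p \<longlongrightarrow> 0) at_bot"
    proof (rule tendsto_sandwich)
      show "eventually (\<lambda>y. 0 \<le> ?F p y) at_bot"
        using erlang_kernel_pos by (auto simp: less_imp_le)
      show "eventually (\<lambda>y. ?F p y \<le> C * exp y) at_bot"
        using eventually_le_at_bot[of 0] by eventually_elim (rule C(2))
      show "((\<lambda>y. C * exp y) \<longlongrightarrow> 0) at_bot"
        by real_asymp
    qed simp
  qed
  moreover have "(LBINT y:{..<0}. R * ?F (p + 1) y - (p + 1) * ?F p y)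
      = R * busy_transform R (p + 1) - (p + 1) * busy_transform R p"
    unfolding busy_transform_def using int by (subst set_integral_diff) auto
  ultimately show ?thesis by (simp add: erlang_kernel_def)
qed

section \<open>The mean queue in closed form\<close>

lemma wait_transform_nonneg: "0 \<le> wait_transform R d p"
  unfolding wait_transform_def set_lebesgue_integral_def
  by (rule Bochner_Integration.integral_nonneg) (simp add: erlang_kernel_pos less_imp_le)

lemma wait_transform_le:
  assumes "0 < R" "0 < d" "0 \<le> p"
  shows "wait_transform R d p \<le> wait_transform R d 0"
  unfolding wait_transform_def
proof (rule set_integral_mono)
  show "set_integrable lborel {0<..} (\<lambda>y. exp (- p * y) * erlang_kernel R d y)"
    "set_integrable lborel {0<..} (\<lambda>y. exp (- 0 * y) * erlang_kernel R d y)"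
    using assms by (intro wait_transform_integrable; simp)+
  show "exp (- p * y) * erlang_kernel R d y \<le> exp (- 0 * y) * erlang_kernel R d y"
    if "y \<in> {0<..}" for y
    using that assms erlang_kernel_pos[of R d y] by (intro mult_right_mono) (auto simp: less_imp_le)
qed

lemma busy_transform_pos:
  assumes "0 < R"
  shows "0 < busy_transform R p"
proof -
  have "0 < (\<integral>y. indicator {..<0} y *\<^sub>R (exp (- p * y) * erlang_kernel R 1 y) \<partial>lborel)"
    using busy_transform_integrable[OF assms, of p] erlang_kernel_pos[of R 1]
    by (intro integral_pos_interval[where a = "-1" and b = 0 and z = 0])
       (auto simp: set_integrable_def less_imp_le split: split_indicator)
  then show ?thesis by (simp add: busy_transform_def set_lebesgue_integral_def)
qed

text \<open>
  Both sides satisfy the same recursion in \<open>n\<close>; the recurrence at \<open>p = -1\<close>, where its first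
  summand vanishes, is the base case.
\<close>

lemma partial_exp_sum_busy_transform:
  assumes "0 < R"
  shows "(\<Sum>k\<le>n. R ^ k / fact k) = R ^ n / fact n * (R * busy_transform R (real n))"
proof (induction n)
  case 0
  then show ?case using busy_transform_recurrence[OF assms, of "-1"] by simp
next
  case (Suc n)
  have frac: "R ^ n / fact n * R = R ^ Suc n / fact (Suc n) * real (Suc n)"
    by (simp add: field_simps del: of_nat_Suc)
  have "(\<Sum>k\<le>Suc n. R ^ k / fact k)
      = R ^ n / fact n * R * busy_transform R (real n) + R ^ Suc n / fact (Suc n)"
    using Suc by (simp add: mult.assoc)
  also have "\<dots> = R ^ Suc n / fact (Suc n) * (real (Suc n) * busy_transform R (real n) + 1)"
    unfolding frac by (simp only: distrib_left mult.assoc mult_1_right)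
  also have "\<dots> = R ^ Suc n / fact (Suc n) * ((real n + 1) * busy_transform R (real n) + 1)"
    by (simp only: of_nat_Suc add.commute)
  also have "\<dots> = R ^ Suc n / fact (Suc n) * (R * busy_transform R (real (Suc n)))"
    using busy_transform_recurrence[OF assms, of "real n"] by (simp add: add.commute)
  finally show ?case .
qed

context
  fixes lam \<mu> \<gamma> R d :: real and s :: nat
  assumes pos: "0 < lam" "0 < \<mu>" "0 < \<gamma>"
    and R: "R = lam / \<mu>" and d: "d = \<gamma> / \<mu>"
begin

private lemma Rd: "0 < R" "0 < d" using pos R d by auto

private abbreviation "w \<equiv> erlang_a_weight lam \<mu> \<gamma> s"

lemma erlang_a_weight_below:
  assumes "k \<le> s"
  shows "w k = R ^ k / fact k"
  using assms
proof (induction k)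
  case 0
  then show ?case by (simp add: erlang_a_weight_def)
next
  case (Suc k)
  have "w (Suc k) = w k * (lam / departure_rate \<mu> \<gamma> s (Suc k))"
    by (simp add: erlang_a_weight_def)
  also have "departure_rate \<mu> \<gamma> s (Suc k) = real (Suc k) * \<mu>"
    using Suc.prems by (simp add: departure_rate_def queue_length_def)
  also have "lam / (real (Suc k) * \<mu>) = R / real (Suc k)"
    using pos R by simp
  also have "w k = R ^ k / fact k"
    using Suc by simp
  finally show ?case by (simp add: field_simps del: of_nat_Suc)
qed

lemma erlang_a_weight_above:
  "w (s + Suc j) * (real s + real j * d + d) = w (s + j) * R"
proof -
  have "w (s + Suc j) = w (s + j) * (lam / departure_rate \<mu> \<gamma> s (Suc (s + j)))"
    by (simp add: erlang_a_weight_def)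
  moreover have "departure_rate \<mu> \<gamma> s (Suc (s + j)) = \<mu> * (real s + real j * d + d)"
    using pos d by (simp add: departure_rate_def queue_length_def min_def field_simps)
  moreover have "0 < real s + real j * d + d"
    using Rd by (intro add_nonneg_pos) auto
  moreover have "lam / (\<mu> * q) * q = R" if "0 < q" for q
    using that pos R by simp
  ultimately show ?thesis by (simp only: mult.assoc)
qed

text \<open>
  The recurrence of the transform makes the weights above \<open>s\<close> telescope: each weight is the
  difference of successive values of weight times transform, and these tend to 0.
\<close>

lemma sums_waiting_weights:
  "(\<lambda>j. w (s + Suc j)) sums (w s * (R * wait_transform R d (real s)))"
proof -
  define U where "U j = wait_transform R d (real s + real j * d)" for j
  have step: "w (s + Suc j) = w (s + j) * (R * U j) - w (s + Suc j) * (R * U (Suc j))" for j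
  proof -
    have "R * U (Suc j) = (real s + real j * d + d) * U j - 1"
      unfolding U_def using wait_transform_recurrence[OF Rd, of "real s + real j * d"] Rd
      by (simp add: algebra_simps)
    then have "w (s + Suc j) * (R * U (Suc j))
        = (w (s + Suc j) * (real s + real j * d + d)) * U j - w (s + Suc j)"
      by (simp only: right_diff_distrib mult.assoc mult_1_right)
    then have "w (s + Suc j) * (R * U (Suc j)) = w (s + j) * R * U j - w (s + Suc j)"
      by (simp only: erlang_a_weight_above)
    then show ?thesis by simp
  qed
  have lim: "(\<lambda>j. w (s + j) * (R * U j)) \<longlonglongrightarrow> 0"
  proof (rule tendsto_sandwich)
    have wpos: "0 < w k" for k by (rule erlang_a_weight_pos[OF pos])
    show "eventually (\<lambda>j. 0 \<le> w (s + j) * (R * U j)) sequentially"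
      using wpos[THEN less_imp_le] wait_transform_nonneg Rd
      by (auto simp: U_def intro!: always_eventually mult_nonneg_nonneg)
    show "eventually (\<lambda>j. w (s + j) * (R * U j) \<le> w (s + j) * (R * wait_transform R d 0)) sequentially"
      using wpos Rd wait_transform_le[OF Rd]
      by (auto simp: U_def intro!: always_eventually mult_left_mono less_imp_le)
    have "(\<lambda>j. w (j + s)) \<longlonglongrightarrow> 0"
      using summable_LIMSEQ_zero[OF summable_erlang_a_weight(1)[OF pos, of s]] by (rule LIMSEQ_ignore_initial_segment)
    then show "(\<lambda>j. w (s + j) * (R * wait_transform R d 0)) \<longlonglongrightarrow> 0"
      by (intro tendsto_mult_left_zero) (simp add: add.commute)
  qed simp
  have "(\<lambda>j. w (s + j) * (R * U j) - w (s + Suc j) * (R * U (Suc j))) sums (w (s + 0) * (R * U 0) - 0)"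
    using lim by (rule telescope_sums')
  then show ?thesis
    by (subst step) (simp add: U_def)
qed

lemma sums_all_weights:
  "w sums (w s * (R * busy_transform R (real s) + R * wait_transform R d (real s)))"
proof -
  have "(\<Sum>k<Suc s. w k) = (\<Sum>k\<le>s. R ^ k / fact k)"
    by (rule sum.cong) (auto simp: erlang_a_weight_below lessThan_Suc_atMost)
  also have "\<dots> = w s * (R * busy_transform R (real s))"
    using partial_exp_sum_busy_transform[OF Rd(1), of s] by (simp add: erlang_a_weight_below)
  finally have "(\<Sum>k<Suc s. w k) = w s * (R * busy_transform R (real s))" .
  moreover have "(\<lambda>j. w (j + Suc s)) sums (w s * (R * wait_transform R d (real s)))"
    using sums_waiting_weights by (simp add: add.commute)
  ultimately show ?thesis
    by (subst sums_iff_shift'[of _ "Suc s", symmetric]) (simp add: algebra_simps)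
qed

text \<open>
  Summing the balance equations \<open>(s + (j + 1) d) w (s + j + 1) = R w (s + j)\<close> over \<open>j\<close> expresses
  the first moment of the weights through their sum.
\<close>

lemma sums_queue_weights:
  "(\<lambda>k. w k * real (k - s)) sums (w s * (R / d + (R / d - real s / d) * (R * wait_transform R d (real s))))"
proof -
  let ?C = "R * wait_transform R d (real s)"
  have "(\<lambda>j. w (s + j)) sums (w s * ?C + w (s + 0))"
    using sums_waiting_weights by (subst (asm) sums_Suc_iff) simp
  then have "(\<lambda>j. (w (s + j) * R - real s * w (s + Suc j)) / d) sums
      (((w s * ?C + w s) * R - real s * (w s * ?C)) / d)"
    using sums_waiting_weights by (intro sums_divide sums_diff sums_mult sums_mult2) auto
  moreover have "(w (s + j) * R - real s * w (s + Suc j)) / d = w (s + Suc j) * real (Suc j)" for j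
    unfolding erlang_a_weight_above[of j, symmetric] using Rd by (simp add: field_simps)
  moreover have "((w s * ?C + w s) * R - real s * (w s * ?C)) / d
      = w s * (R / d + (R / d - real s / d) * ?C)"
    using Rd by (simp add: field_simps)
  ultimately have "(\<lambda>j. w (s + Suc j) * real (Suc j)) sums (w s * (R / d + (R / d - real s / d) * ?C))"
    by (simp only:)
  then have "(\<lambda>j. w (j + Suc s) * real (j + Suc s - s)) sums (w s * (R / d + (R / d - real s / d) * ?C))"
    by (simp add: add.commute)
  then show ?thesis
    by (subst sums_iff_shift'[of _ "Suc s", symmetric]) simp
qed

end

text \<open>
  Defined for real \<open>s\<close>, since the quasi-convexity argument and the scaling both treat the number of
  servers as a continuous parameter.
\<close>

definition erlang_queue :: "real \<Rightarrow> real \<Rightarrow> real \<Rightarrow> real" where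
  "erlang_queue R d s = (R / d + (R / d - s / d) * (R * wait_transform R d s)) /
     (R * busy_transform R s + R * wait_transform R d s)"

lemma mean_queue_eq_erlang_queue:
  assumes pos: "0 < lam" "0 < \<mu>" "0 < \<gamma>"
  shows "mean_queue lam \<mu> \<gamma> s = erlang_queue (lam / \<mu>) (\<gamma> / \<mu>) (real s)"
proof -
  define R where "R = lam / \<mu>"
  define d where "d = \<gamma> / \<mu>"
  let ?p = "steady_state lam \<mu> \<gamma> s" and ?w = "erlang_a_weight lam \<mu> \<gamma> s"
  let ?Z = "R * busy_transform R (real s) + R * wait_transform R d (real s)"
  let ?N = "R / d + (R / d - real s / d) * (R * wait_transform R d (real s))"
  have e: "pmf ?p k = pmf ?p 0 * ?w k" for k
    using stationary_steady_state[OF pos, of s] unfolding stationary_pmf_iff[OF pos] by blast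
  have R: "0 < R" using pos by (simp add: R_def)
  have ws: "0 < ?w s" by (rule erlang_a_weight_pos[OF pos])
  have Z: "0 < ?Z"
    using R busy_transform_pos[OF R] wait_transform_nonneg by (intro add_pos_nonneg) auto
  have "(\<lambda>k. pmf ?p k) sums (pmf ?p 0 * (?w s * ?Z))"
    by (subst e) (intro sums_mult sums_all_weights[OF pos R_def d_def])
  moreover have "(\<lambda>k. pmf ?p k) sums 1"
  proof -
    have "(\<lambda>k. measure (measure_pmf ?p) {k}) sums measure (measure_pmf ?p) (\<Union>k. {k})"
      by (rule measure_pmf.finite_measure_UNION) (auto simp: disjoint_family_on_def)
    then show ?thesis by (simp add: measure_pmf_single)
  qed
  ultimately have total: "pmf ?p 0 * (?w s * ?Z) = 1" by (rule sums_unique2)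
  have "(\<lambda>k. pmf ?p k * real (k - s)) sums (pmf ?p 0 * (?w s * ?N))"
    using sums_mult[OF sums_queue_weights[OF pos R_def d_def, of s], of "pmf ?p 0"]
    by (subst e) (simp add: mult.assoc)
  moreover have "(\<lambda>k. pmf ?p k * real (k - s)) sums mean_queue lam \<mu> \<gamma> s"
  proof -
    have int: "integrable (count_space UNIV) (\<lambda>k. pmf ?p k * real (k - s))"
      using integrable_queue_length[OF pos, of s]
      by (simp add: measure_pmf_eq_density integrable_density queue_length_def)
    have "mean_queue lam \<mu> \<gamma> s = (\<integral>k. pmf ?p k * real (k - s) \<partial>count_space UNIV)"
      unfolding mean_queue_def queue_length_def
      by (subst measure_pmf_eq_density, subst integral_density) auto
    with sums_integral_count_space_nat[OF int] show ?thesis by simp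
  qed
  ultimately have "mean_queue lam \<mu> \<gamma> s = pmf ?p 0 * (?w s * ?N)" by (rule sums_unique2[symmetric])
  also have "\<dots> = pmf ?p 0 * (?w s * ?Z) * (?N / ?Z)" using Z by simp
  also have "\<dots> = ?N / ?Z" by (simp only: total)
  finally show ?thesis by (simp add: erlang_queue_def R_def d_def)
qed

section \<open>Quasi-convexity of the exact cost\<close>

text \<open>
  By the two recurrences, multiplication of the transforms by \<open>s\<close> corresponds to multiplication
  of the kernel by \<open>R exp (- d y) - d\<close>. This identifies the function \<open>g\<close> whose tilted mean is the
  cost; on the positive half line it is a constant plus \<open>R (c - h / d) exp (- d y)\<close>, which is
  increasing exactly because \<open>c < h / d\<close>.
\<close>

lemma erlang_cost_strictly_quasiconvex:
  fixes R d h c s1 s2 s3 :: real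
  assumes pos: "0 < R" "0 < d" "0 < h" "0 < c" and cheap: "c < h / d"
    and s: "0 \<le> s1" "s1 < s3" "s3 < s2"
  shows "h * erlang_queue R d s3 + c * s3
    < max (h * erlang_queue R d s1 + c * s1) (h * erlang_queue R d s2 + c * s2)"
proof -
  define x where "x = R / d"
  let ?m = "\<lambda>y. if y < 0 then erlang_kernel R 1 y else erlang_kernel R d y"
  let ?g = "\<lambda>y. if y < 0 then c * (R * exp (- y) - 1)
    else h * (1 + x) - c * d + (c * R - h * x) * exp (- d * y)"
  let ?L = "\<lambda>p y. exp (- p * y) * erlang_kernel R 1 y"
  let ?U = "\<lambda>p y. exp (- p * y) * erlang_kernel R d y"
  have iL: "set_integrable lborel {..<0} (?L p)" for p by (rule busy_transform_integrable[OF pos(1)])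
  have iU: "set_integrable lborel {0<..} (?U p)" if "0 \<le> p" for p
    by (rule wait_transform_integrable[OF pos(1,2) that])
  have coeff: "c * R - h * x < 0"
  proof -
    have "R * c < R * (h / d)" using cheap pos by (intro mult_strict_left_mono)
    then show ?thesis by (simp add: x_def mult.commute)
  qed
  have Zint: "integrable lborel (\<lambda>y. exp (- s * y) * ?m y)"
    and Zval: "(\<integral>y. exp (- s * y) * ?m y \<partial>lborel) = busy_transform R s + wait_transform R d s"
    if "0 \<le> s" for s
    using integral_split_at_zero[OF iL[of s] iU[OF that], of "\<lambda>y. exp (- s * y) * ?m y"]
    by (auto simp: busy_transform_def wait_transform_def)
  have gint: "integrable lborel (\<lambda>y. ?g y * (exp (- s * y) * ?m y))" (is ?I)
    and gval: "(\<integral>y. ?g y * (exp (- s * y) * ?m y) \<partial>lborel)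
      = c * s * (busy_transform R s + wait_transform R d s)
        + h * (1 / d + (x - s / d) * wait_transform R d s)" (is ?V)
    if "0 \<le> s" for s
  proof -
    let ?l = "\<lambda>y. (c * R) * ?L (s + 1) y - c * ?L s y"
    let ?u = "\<lambda>y. (h * (1 + x) - c * d) * ?U s y + (c * R - h * x) * ?U (s + d) y"
    have sd: "0 \<le> s + d" using that pos by simp
    have il: "set_integrable lborel {..<0} ?l"
      by (intro set_integral_diff set_integrable_mult_right iL)
    have iu: "set_integrable lborel {0<..} ?u"
      by (intro set_integral_add set_integrable_mult_right iU that sd)
    have meas: "(\<lambda>y. ?g y * (exp (- s * y) * ?m y)) \<in> borel_measurable borel" by measurable
    have left: "?g y * (exp (- s * y) * ?m y) = ?l y" if "y < 0" for y
    proof -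
      have "exp (- (s + 1) * y) = exp (- y) * exp (- s * y)"
        by (simp add: mult_exp_exp algebra_simps)
      then show ?thesis using that by (simp only: if_True) (simp add: algebra_simps)
    qed
    have right: "?g y * (exp (- s * y) * ?m y) = ?u y" if "0 < y" for y
    proof -
      have "exp (- (s + d) * y) = exp (- d * y) * exp (- s * y)"
        by (simp add: mult_exp_exp algebra_simps)
      then show ?thesis using that by (simp only:) (simp add: algebra_simps)
    qed
    note split = integral_split_at_zero[OF il iu left right meas]
    show ?I by (rule split(1))
    have "(\<integral>y. ?g y * (exp (- s * y) * ?m y) \<partial>lborel) = (LBINT y:{..<0}. ?l y) + (LBINT y:{0<..}. ?u y)"
      by (rule split(2))
    also have "(LBINT y:{..<0}. ?l y) = c * R * busy_transform R (s + 1) - c * busy_transform R s"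
      unfolding busy_transform_def
      by (subst set_integral_diff) (intro set_integrable_mult_right iL, intro set_integrable_mult_right iL, simp)
    also have "(LBINT y:{0<..}. ?u y)
        = (h * (1 + x) - c * d) * wait_transform R d s + (c * R - h * x) * wait_transform R d (s + d)"
      unfolding wait_transform_def
      by (subst set_integral_add)
         (intro set_integrable_mult_right iU that, intro set_integrable_mult_right iU sd, simp)
    also have "c * R * busy_transform R (s + 1) = c * ((s + 1) * busy_transform R s + 1)"
      using busy_transform_recurrence[OF pos(1), of s] by (simp add: mult.assoc)
    also have "(c * R - h * x) * wait_transform R d (s + d) = (c - h / d) * (R * wait_transform R d (s + d))"
      by (simp add: x_def algebra_simps)
    also have "R * wait_transform R d (s + d) = (s + d) * wait_transform R d s - 1"
      by (rule wait_transform_recurrence[OF pos(1,2) that])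
    also have "c * ((s + 1) * busy_transform R s + 1) - c * busy_transform R s +
        ((h * (1 + x) - c * d) * wait_transform R d s + (c - h / d) * ((s + d) * wait_transform R d s - 1))
        = c * s * (busy_transform R s + wait_transform R d s)
        + h * (1 / d + (x - s / d) * wait_transform R d s)"
      using pos by (simp add: field_simps)
    finally show ?V .
  qed
  show ?thesis
  proof (rule tilted_mean_strictly_quasiconvex[where f = "\<lambda>s. h * erlang_queue R d s + c * s"
        and m = ?m and g = ?g, OF _ s(2,3)])
    show "0 < ?m y" for y by (simp add: erlang_kernel_pos)
    fix s assume "s \<in> {s1, s2, s3}"
    then have s0: "0 \<le> s" using s by auto
    show "integrable lborel (\<lambda>y. exp (- s * y) * ?m y)" by (rule Zint[OF s0])
    show "integrable lborel (\<lambda>y. ?g y * (exp (- s * y) * ?m y))" by (rule gint[OF s0])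
    have Zpos: "0 < busy_transform R s + wait_transform R d s"
      using busy_transform_pos[OF pos(1), of s] wait_transform_nonneg[of R d s] by linarith
    have "erlang_queue R d s = R * (1 / d + (x - s / d) * wait_transform R d s)
        / (R * (busy_transform R s + wait_transform R d s))"
      unfolding erlang_queue_def x_def by (simp add: algebra_simps)
    then have q: "erlang_queue R d s * (busy_transform R s + wait_transform R d s)
        = 1 / d + (x - s / d) * wait_transform R d s"
      using Zpos pos by simp
    show "(h * erlang_queue R d s + c * s) * (\<integral>y. exp (- s * y) * ?m y \<partial>lborel)
        = (\<integral>y. ?g y * (exp (- s * y) * ?m y) \<partial>lborel)"
      unfolding Zval[OF s0] gval[OF s0] q[symmetric] by (simp add: algebra_simps)
  next
    show "?g y \<le> ?g x" if "x < y" "y < 0" for x y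
      using that pos by (auto intro!: mult_left_mono)
    show "?g x' \<le> ?g y" if "0 \<le> x'" "x' < y" for x' y
      using that pos coeff by (auto intro!: mult_left_mono_neg)
    have "filterlim (\<lambda>y. c * (R * exp (- y) - 1)) at_top at_bot"
      using pos by real_asymp
    then show "filterlim ?g at_top at_bot"
      by (rule filterlim_mono_eventually)
         (auto intro!: eventually_mono[OF eventually_gt_at_bot[of 0]] simp: eventually_at_bot_dense)
  qed
qed

section \<open>Gaussian limits of the transforms\<close>

text \<open>
  The kernel after the substitution \<open>y = e u\<close> with \<open>R = 1 / e\<^sup>2\<close> and \<open>s = R + \<sigma> / e\<close>. As \<open>e\<close>
  tends to 0, the exponent tends to \<open>- \<sigma> u - d u\<^sup>2 / 2\<close>.
\<close>

definition scaled_transform :: "real \<Rightarrow> real set \<Rightarrow> real \<Rightarrow> real \<Rightarrow> real" where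
  "scaled_transform d S e \<sigma> =
     (LBINT u:S. exp (- \<sigma> * u - d * e * u - (exp (- (d * e * u)) - 1 + d * e * u) / (d * e\<^sup>2)))"

definition gauss_transform :: "real \<Rightarrow> real set \<Rightarrow> real \<Rightarrow> real" where
  "gauss_transform d S \<sigma> = (LBINT u:S. exp (- \<sigma> * u - d * u\<^sup>2 / 2))"

lemma busy_transform_scaled:
  assumes "0 < e" "R = 1 / e\<^sup>2"
  shows "R * busy_transform R (R + \<sigma> / e) = scaled_transform 1 {..<0} e \<sigma> / e"
proof -
  let ?f = "\<lambda>y. indicator {..<0} y *\<^sub>R (exp (- (R + \<sigma> / e) * y) * erlang_kernel R 1 y)"
  have "busy_transform R (R + \<sigma> / e) = \<bar>e\<bar> *\<^sub>R (\<integral>u. ?f (0 + e * u) \<partial>lborel)"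
    unfolding busy_transform_def set_lebesgue_integral_def
    using assms by (intro lborel_integral_real_affine) auto
  also have "(\<integral>u. ?f (0 + e * u) \<partial>lborel) = scaled_transform 1 {..<0} e \<sigma>"
    unfolding scaled_transform_def set_lebesgue_integral_def
  proof (rule Bochner_Integration.integral_cong)
    fix u
    have "- (R + \<sigma> / e) * (e * u) + (R / 1 * (1 - exp (- 1 * (e * u))) - 1 * (e * u))
        = - \<sigma> * u - 1 * e * u - (exp (- (1 * e * u)) - 1 + 1 * e * u) / (1 * e\<^sup>2)"
      using assms(1) unfolding assms(2) by (simp add: field_simps power2_eq_square)
    then show "?f (0 + e * u) = indicator {..<0} u *\<^sub>R
        exp (- \<sigma> * u - 1 * e * u - (exp (- (1 * e * u)) - 1 + 1 * e * u) / (1 * e\<^sup>2))"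
      using assms(1) unfolding erlang_kernel_def mult_exp_exp
      by (auto simp: mult_less_0_iff split: split_indicator)
  qed simp
  finally show ?thesis using assms by (simp add: power2_eq_square)
qed

lemma wait_transform_scaled:
  assumes "0 < e" "0 < d" "R = 1 / e\<^sup>2"
  shows "R * wait_transform R d (R + \<sigma> / e) = scaled_transform d {0<..} e \<sigma> / e"
proof -
  let ?f = "\<lambda>y. indicator {0<..} y *\<^sub>R (exp (- (R + \<sigma> / e) * y) * erlang_kernel R d y)"
  have "wait_transform R d (R + \<sigma> / e) = \<bar>e\<bar> *\<^sub>R (\<integral>u. ?f (0 + e * u) \<partial>lborel)"
    unfolding wait_transform_def set_lebesgue_integral_def
    using assms by (intro lborel_integral_real_affine) auto
  also have "(\<integral>u. ?f (0 + e * u) \<partial>lborel) = scaled_transform d {0<..} e \<sigma>"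
    unfolding scaled_transform_def set_lebesgue_integral_def
  proof (rule Bochner_Integration.integral_cong)
    fix u
    have "- (R + \<sigma> / e) * (e * u) + (R / d * (1 - exp (- d * (e * u))) - d * (e * u))
        = - \<sigma> * u - d * e * u - (exp (- (d * e * u)) - 1 + d * e * u) / (d * e\<^sup>2)"
      using assms(1) assms(2) unfolding assms(3) by (simp add: field_simps power2_eq_square)
    then show "?f (0 + e * u) = indicator {0<..} u *\<^sub>R
        exp (- \<sigma> * u - d * e * u - (exp (- (d * e * u)) - 1 + d * e * u) / (d * e\<^sup>2))"
      using assms(1) unfolding erlang_kernel_def mult_exp_exp
      by (auto simp: zero_less_mult_iff split: split_indicator)
  qed simp
  finally show ?thesis using assms by (simp add: power2_eq_square)
qed

text \<open>
  A linear lower bound valid on the whole line. For \<open>x < 0\<close> it is the tangent of \<open>exp\<close> at the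
  point with slope \<open>1 - \<theta>\<close>. It yields an integrable majorant of the scaled kernels on the side
  where their decay is only exponential.
\<close>

lemma exp_minus_tangent_ge:
  fixes x \<theta> :: real
  assumes "0 \<le> \<theta>" "\<theta> < 1"
  shows "\<theta> * \<bar>x\<bar> - \<theta>\<^sup>2 \<le> exp x - 1 - x"
proof (cases "0 \<le> x")
  case True
  have "0 \<le> (x - \<theta>)\<^sup>2 + \<theta>\<^sup>2" by simp
  then have "\<theta> * x - \<theta>\<^sup>2 \<le> x\<^sup>2 / 2" by (simp add: power2_eq_square algebra_simps)
  with exp_lower_Taylor_quadratic[OF True] True show ?thesis by simp
next
  case False
  define p where "p = - ln (1 - \<theta>)"
  have p: "exp (- p) = 1 - \<theta>" "\<theta> \<le> p"
    using assms ln_add_one_self_le_self2[of "- \<theta>"] by (auto simp: p_def)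
  have "(1 - \<theta>) * (1 + (x + p)) \<le> exp (- p) * exp (x + p)"
    unfolding p(1) using assms by (intro mult_left_mono) auto
  also have "\<dots> = exp x" by (simp flip: exp_add)
  finally have "(1 - \<theta>) * (1 + (x + p)) \<le> exp x" .
  moreover have "(1 - \<theta>) * (1 + (x + \<theta>)) \<le> (1 - \<theta>) * (1 + (x + p))"
    using assms p by (intro mult_left_mono) auto
  ultimately show ?thesis using False by (simp add: power2_eq_square algebra_simps)
qed

lemma exp_cubic_remainder_le:
  fixes x :: real
  shows "\<bar>exp x - 1 - x - x\<^sup>2 / 2\<bar> \<le> \<bar>x\<bar> ^ 3 * exp \<bar>x\<bar>"
proof -
  obtain t where t: "\<bar>t\<bar> \<le> \<bar>x\<bar>" "exp x = (\<Sum>m<3. x ^ m / fact m) + exp t / fact 3 * x ^ 3"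
    using Maclaurin_exp_le by blast
  have "exp x - 1 - x - x\<^sup>2 / 2 = exp t / 6 * x ^ 3"
    using t(2) by (simp add: eval_nat_numeral)
  also have "\<bar>\<dots>\<bar> = \<bar>x\<bar> ^ 3 * (exp t / 6)" by (simp add: abs_mult power_abs)
  also have "\<dots> \<le> \<bar>x\<bar> ^ 3 * exp \<bar>x\<bar>"
  proof (intro mult_left_mono)
    have "exp t \<le> exp \<bar>x\<bar>" using t(1) by simp
    then show "exp t / 6 \<le> exp \<bar>x\<bar>" using exp_gt_zero[of t] by linarith
  qed simp
  finally show ?thesis .
qed

lemma abs_exp_diff_le:
  fixes a b M :: real
  assumes "exp a \<le> M" "exp b \<le> M"
  shows "\<bar>exp a - exp b\<bar> \<le> \<bar>a - b\<bar> * M"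
proof -
  have *: "exp v - exp u \<le> (v - u) * M" if "u \<le> v" "exp v \<le> M" for u v
  proof -
    have "exp v * (1 + (u - v)) \<le> exp v * exp (u - v)" by (intro mult_left_mono) auto
    then have "exp v - exp u \<le> (v - u) * exp v" by (simp add: algebra_simps flip: exp_add)
    also have "\<dots> \<le> (v - u) * M" using that by (intro mult_left_mono) auto
    finally show ?thesis .
  qed
  show ?thesis
    using *[of a b] *[of b a] assms by (cases "a \<le> b") auto
qed

context
  fixes d :: real
  assumes d: "0 < d"
begin

private abbreviation (input) "E e \<sigma> u \<equiv>
  - \<sigma> * u - d * e * u - (exp (- (d * e * u)) - 1 + d * e * u) / (d * e\<^sup>2)"

private abbreviation (input) "E0 \<sigma> u \<equiv> - \<sigma> * u - d * u\<^sup>2 / 2"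

text \<open>
  The bound is weaker than a Gaussian one so that it has the same form as the bound for the scaled
  exponent below; a single majorant then serves for both.
\<close>

lemma gauss_exponent_le:
  assumes "\<bar>\<sigma>\<bar> \<le> a" "0 \<le> k"
  shows "exp (E0 \<sigma> u) \<le> exp (k\<^sup>2 / d) * exp ((a + 1 - k) * \<bar>u\<bar>)"
proof -
  have "- \<sigma> * u \<le> a * \<bar>u\<bar>"
    using assms(1) by (metis abs_ge_minus_self abs_ge_zero abs_mult minus_mult_left mult_right_mono order_trans)
  moreover have "k * \<bar>u\<bar> \<le> k\<^sup>2 / d + d * u\<^sup>2 / 2"
  proof -
    have "0 \<le> (d * \<bar>u\<bar> - k)\<^sup>2 + k\<^sup>2" by simp
    then have "2 * d * (k * \<bar>u\<bar>) \<le> 2 * k\<^sup>2 + d\<^sup>2 * u\<^sup>2"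
      by (simp add: power2_eq_square algebra_simps flip: abs_mult)
    then show ?thesis using d by (simp add: field_simps power2_eq_square)
  qed
  ultimately have "E0 \<sigma> u \<le> k\<^sup>2 / d + (a + 1 - k) * \<bar>u\<bar>"
    by (simp add: algebra_simps)
  then show ?thesis by (simp flip: exp_add)
qed

text \<open>
  The decay rate \<open>k\<close> can be made as large as needed to beat the tilt, at the price of restricting
  to \<open>e < 1 / k\<close>.
\<close>

lemma scaled_exponent_le:
  assumes "\<bar>\<sigma>\<bar> \<le> a" "0 \<le> k" "0 < e" "d * e \<le> 1" "k * e < 1"
  shows "exp (E e \<sigma> u) \<le> exp (k\<^sup>2 / d) * exp ((a + 1 - k) * \<bar>u\<bar>)"
proof -
  have "- \<sigma> * u \<le> a * \<bar>u\<bar>"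
    using assms(1) by (metis abs_ge_minus_self abs_ge_zero abs_mult minus_mult_left mult_right_mono order_trans)
  moreover have "- (d * e * u) \<le> 1 * \<bar>u\<bar>"
  proof -
    have "- (d * e * u) \<le> (d * e) * \<bar>u\<bar>" using d assms(3)
      by (metis abs_ge_minus_self abs_mult abs_of_pos mult_pos_pos)
    also have "\<dots> \<le> 1 * \<bar>u\<bar>" using assms by (intro mult_right_mono) auto
    finally show ?thesis .
  qed
  moreover have "k * \<bar>u\<bar> - k\<^sup>2 / d \<le> (exp (- (d * e * u)) - 1 + d * e * u) / (d * e\<^sup>2)"
  proof -
    have "k * e * \<bar>- (d * e * u)\<bar> - (k * e)\<^sup>2 \<le> exp (- (d * e * u)) - 1 - (- (d * e * u))"
      using assms by (intro exp_minus_tangent_ge) auto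
    then have "(k * e * \<bar>- (d * e * u)\<bar> - (k * e)\<^sup>2) / (d * e\<^sup>2)
        \<le> (exp (- (d * e * u)) - 1 + d * e * u) / (d * e\<^sup>2)"
      using d by (intro divide_right_mono) auto
    moreover have "(k * e * \<bar>- (d * e * u)\<bar> - (k * e)\<^sup>2) / (d * e\<^sup>2) = k * \<bar>u\<bar> - k\<^sup>2 / d"
      using d assms(3) by (simp add: abs_mult field_simps power2_eq_square)
    ultimately show ?thesis by simp
  qed
  ultimately have "E e \<sigma> u \<le> k\<^sup>2 / d + (a + 1 - k) * \<bar>u\<bar>"
    by (simp add: algebra_simps)
  then show ?thesis by (simp flip: exp_add)
qed

lemma scaled_exponent_diff_le:
  assumes "0 < e" "d * e \<le> 1"
  shows "\<bar>E e \<sigma> u - E0 \<sigma> u\<bar> \<le> e * ((d + 6 * d\<^sup>2) * exp (2 * \<bar>u\<bar>))"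
proof -
  define x where "x = - (d * e * u)"
  have de: "0 < d * e" using d assms by simp
  have xu: "\<bar>x\<bar> = d * e * \<bar>u\<bar>" using de by (simp add: x_def abs_mult[of "d * e" u])
  have "E e \<sigma> u - E0 \<sigma> u = x - (exp x - 1 - x - x\<^sup>2 / 2) / (d * e\<^sup>2)"
    using d assms by (simp add: x_def field_simps power2_eq_square)
  also have "\<bar>\<dots>\<bar> \<le> \<bar>x\<bar> + \<bar>exp x - 1 - x - x\<^sup>2 / 2\<bar> / (d * e\<^sup>2)"
    using d by (intro order_trans[OF abs_triangle_ineq4]) simp
  also have "\<dots> \<le> \<bar>x\<bar> + \<bar>x\<bar> ^ 3 * exp \<bar>x\<bar> / (d * e\<^sup>2)"
    using d by (intro add_mono divide_right_mono exp_cubic_remainder_le) auto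
  also have "\<dots> = e * (d * \<bar>u\<bar> + d\<^sup>2 * (\<bar>u\<bar> ^ 3 * exp \<bar>x\<bar>))"
    unfolding xu using d assms by (simp add: field_simps power2_eq_square power3_eq_cube)
  also have "\<dots> \<le> e * (d * exp (2 * \<bar>u\<bar>) + d\<^sup>2 * (6 * exp \<bar>u\<bar> * exp \<bar>u\<bar>))"
  proof (intro mult_left_mono add_mono mult_mono)
    have "\<bar>u\<bar> \<le> exp \<bar>u\<bar>" using exp_ge_add_one_self[of "\<bar>u\<bar>"] by linarith
    also have "\<dots> \<le> exp (2 * \<bar>u\<bar>)" by simp
    finally show "\<bar>u\<bar> \<le> exp (2 * \<bar>u\<bar>)" .
    have "\<bar>u\<bar> ^ 3 / fact 3 \<le> exp \<bar>u\<bar>" by (rule exp_ge_power_div_fact) simp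
    then show "\<bar>u\<bar> ^ 3 \<le> 6 * exp \<bar>u\<bar>" by (simp add: fact_numeral)
    have "d * e * \<bar>u\<bar> \<le> 1 * \<bar>u\<bar>" using assms by (intro mult_right_mono) auto
    then show "exp \<bar>x\<bar> \<le> exp \<bar>u\<bar>" by (simp add: xu)
  qed (use d assms in auto)
  also have "\<dots> = e * ((d + 6 * d\<^sup>2) * exp (2 * \<bar>u\<bar>))"
    by (simp add: algebra_simps mult_exp_exp)
  finally show ?thesis .
qed

text \<open>
  The tilt \<open>\<sigma>\<close> cancels in the difference of the exponents, which is \<open>e\<close> times a quantity with
  a limit: the summand \<open>- d u\<close> comes from the term \<open>- d e u\<close>, the cubic from the third-order Taylor
  term of the exponential.
\<close>

lemma scaled_exponent_limit:
  "((\<lambda>e. (exp (E e \<sigma> u - E0 \<sigma> u) - 1) / e) \<longlongrightarrow> - d * u + d\<^sup>2 * u ^ 3 / 6) (at_right 0)"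
proof -
  define q where "q e = (E e \<sigma> u - E0 \<sigma> u) / e" for e
  define \<Phi> where "\<Phi> z = (if z = 0 then 1 else (exp z - 1) / z)" for z :: real
  have "(\<Phi> \<longlongrightarrow> 1) (at 0)"
    using lim_exp_minus_1[where 'a = real]
    by (rule Lim_transform_eventually) (auto simp: \<Phi>_def eventually_at_filter)
  moreover have "\<Phi> 0 = 1" by (simp add: \<Phi>_def)
  ultimately have "isCont \<Phi> 0" by (simp add: isCont_def)
  have rest: "((\<lambda>e. (exp (- (d * e * u)) - 1 + d * e * u - (d * e * u)\<^sup>2 / 2) / (d * e ^ 3))
      \<longlongrightarrow> - d\<^sup>2 * u ^ 3 / 6) (at_right 0)"
  proof -
    have third: "((\<lambda>z::real. (exp z - 1 - z - z\<^sup>2 / 2) / z ^ 3) \<longlongrightarrow> 1 / 6) (at 0)"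
      by real_asymp
    show ?thesis
    proof (cases "u = 0")
      case False
      have "filterlim (\<lambda>e. - (d * e * u)) (at 0) (at_right 0)"
        unfolding filterlim_at
      proof (intro conjI)
        show "((\<lambda>e. - (d * e * u)) \<longlongrightarrow> 0) (at_right 0)"
          by (auto intro!: tendsto_eq_intros)
        show "eventually (\<lambda>e. - (d * e * u) \<in> UNIV \<and> - (d * e * u) \<noteq> 0) (at_right 0)"
          using False d by (auto simp: eventually_at_filter)
      qed
      from tendsto_mult[OF filterlim_compose[OF third this] tendsto_const[of "- d\<^sup>2 * u ^ 3"]]
      show ?thesis
      proof (rule Lim_transform_eventually[THEN tendsto_eq_rhs])
        have "(exp z - 1 - z - z\<^sup>2 / 2) / z ^ 3 * (- d\<^sup>2 * u ^ 3)
            = (exp z - 1 - z - z\<^sup>2 / 2) / (d * e ^ 3)" if "0 < e" "z = - (d * e * u)" for e z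
        proof -
          have cancel: "N / (q * w) * q = N / w" if "q \<noteq> 0" for N q w :: real
            using that by simp
          have "z ^ 3 = (- d\<^sup>2 * u ^ 3) * (d * e ^ 3)"
            using that by (simp add: power2_eq_square power3_eq_cube)
          moreover have "- d\<^sup>2 * u ^ 3 \<noteq> 0" using False d by simp
          ultimately show ?thesis by (simp only: cancel not_False_eq_True)
        qed
        then have "(exp (- (d * e * u)) - 1 - - (d * e * u) - (- (d * e * u))\<^sup>2 / 2) / (- (d * e * u)) ^ 3 * (- d\<^sup>2 * u ^ 3)
            = (exp (- (d * e * u)) - 1 + d * e * u - (d * e * u)\<^sup>2 / 2) / (d * e ^ 3)" if "0 < e" for e
          using that by simp
        then show "eventually (\<lambda>e. (exp (- (d * e * u)) - 1 - - (d * e * u) - (- (d * e * u))\<^sup>2 / 2) / (- (d * e * u)) ^ 3 * (- d\<^sup>2 * u ^ 3)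
            = (exp (- (d * e * u)) - 1 + d * e * u - (d * e * u)\<^sup>2 / 2) / (d * e ^ 3)) (at_right 0)"
          by (auto simp: eventually_at_filter)
      qed simp
    qed simp
  qed
  have pos: "eventually (\<lambda>e::real. 0 < e) (at_right 0)"
    by (simp add: eventually_at_right_less)
  have "((\<lambda>e. - d * u - (exp (- (d * e * u)) - 1 + d * e * u - (d * e * u)\<^sup>2 / 2) / (d * e ^ 3))
      \<longlongrightarrow> - d * u - (- d\<^sup>2 * u ^ 3 / 6)) (at_right 0)"
    by (intro tendsto_intros rest)
  then have q: "(q \<longlongrightarrow> - d * u + d\<^sup>2 * u ^ 3 / 6) (at_right 0)"
  proof (rule Lim_transform_eventually[THEN tendsto_eq_rhs])
    show "eventually (\<lambda>e. - d * u - (exp (- (d * e * u)) - 1 + d * e * u - (d * e * u)\<^sup>2 / 2) / (d * e ^ 3)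
        = q e) (at_right 0)"
      using pos by eventually_elim
        (use d in \<open>simp add: q_def field_simps power2_eq_square power3_eq_cube\<close>)
  qed simp
  have "((\<lambda>e. e * q e) \<longlongrightarrow> 0 * (- d * u + d\<^sup>2 * u ^ 3 / 6)) (at_right 0)"
    by (intro tendsto_mult q tendsto_ident_at)
  then have "((\<lambda>e. \<Phi> (e * q e)) \<longlongrightarrow> \<Phi> 0) (at_right 0)"
    by (intro isCont_tendsto_compose[OF \<open>isCont \<Phi> 0\<close>]) simp
  then have "((\<lambda>e. q e * \<Phi> (e * q e)) \<longlongrightarrow> (- d * u + d\<^sup>2 * u ^ 3 / 6) * \<Phi> 0) (at_right 0)"
    by (intro tendsto_mult q)
  then show ?thesis
  proof (rule Lim_transform_eventually[THEN tendsto_eq_rhs])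
    show "eventually (\<lambda>e. q e * \<Phi> (e * q e) = (exp (E e \<sigma> u - E0 \<sigma> u) - 1) / e) (at_right 0)"
      using pos
    proof eventually_elim
      case (elim e)
      then have "E e \<sigma> u - E0 \<sigma> u = e * q e" by (simp add: q_def)
      then show ?case using elim by (simp only:) (simp add: \<Phi>_def)
    qed
  qed (simp add: \<Phi>_def)
qed

lemma gauss_integrable:
  assumes "S \<in> sets borel"
  shows "set_integrable lborel S (\<lambda>u. exp (E0 \<sigma> u))"
  unfolding set_integrable_def
proof (rule Bochner_Integration.integrable_bound)
  let ?k = "\<bar>\<sigma>\<bar> + 2"
  show "integrable lborel (\<lambda>u. exp (?k\<^sup>2 / d) * exp (- 1 * \<bar>u\<bar>))"
    by (intro integrable_mult_right integrable_exp_neg_abs) simp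
  show "AE u in lborel. norm (indicator S u *\<^sub>R exp (E0 \<sigma> u)) \<le> norm (exp (?k\<^sup>2 / d) * exp (- 1 * \<bar>u\<bar>))"
    using gauss_exponent_le[of \<sigma> "\<bar>\<sigma>\<bar>" ?k] by (intro AE_I2) (auto split: split_indicator)
qed (use assms in measurable)

text \<open>
  First-order expansion in \<open>e\<close>, uniform enough to hold along a moving tilt: the limit depends
  only on the limit of \<open>\<sigma>\<close>. This is what makes the constants of two staffing levels cancel when
  their tilts have the same limit.
\<close>

lemma scaled_transform_expansion:
  fixes \<sigma> e :: "real \<Rightarrow> real"
  assumes \<sigma>: "(\<sigma> \<longlongrightarrow> \<sigma>0) at_top" and e: "filterlim e (at_right 0) at_top" and S: "S \<in> sets borel"
  shows "((\<lambda>t. (scaled_transform d S (e t) (\<sigma> t) - gauss_transform d S (\<sigma> t)) / e t) \<longlongrightarrow>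
    (LBINT u:S. exp (E0 \<sigma>0 u) * (- d * u + d\<^sup>2 * u ^ 3 / 6))) at_top"
proof -
  define a where "a = \<bar>\<sigma>0\<bar> + 1"
  \<comment> \<open>Decay rate 5 above the tilt bound: 1 is lost to the term \<open>- d e u\<close>, and 2 to the polynomial
    factors, which \<open>exp (2 * \<bar>u\<bar>)\<close> dominates; rate 2 remains.\<close>
  define k where "k = a + 5"
  define K where "K = exp (k\<^sup>2 / d)"
  have k: "0 < k" by (simp add: k_def a_def)
  have ev_\<sigma>: "eventually (\<lambda>t. \<bar>\<sigma> t\<bar> \<le> a) at_top"
  proof -
    have "eventually (\<lambda>t. \<bar>\<sigma> t\<bar> < a) at_top"
      using tendsto_rabs[OF \<sigma>] by (rule order_tendstoD) (simp add: a_def)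
    then show ?thesis by eventually_elim simp
  qed
  have e0: "(e \<longlongrightarrow> 0) at_top" and ev_e: "eventually (\<lambda>t. 0 < e t) at_top"
    using e by (auto simp: filterlim_at elim: eventually_mono)
  have "eventually (\<lambda>t. d * e t < 1) at_top" "eventually (\<lambda>t. k * e t < 1) at_top"
    using tendsto_mult_right_zero[OF e0] by (auto intro!: order_tendstoD(2)[where a = 1] tendsto_mult_right_zero[OF e0])
  with ev_\<sigma> ev_e have good: "eventually (\<lambda>t. \<bar>\<sigma> t\<bar> \<le> a \<and> 0 < e t \<and> d * e t \<le> 1 \<and> k * e t < 1) at_top"
    by eventually_elim auto
  let ?f = "\<lambda>t u. indicator S u * ((exp (E (e t) (\<sigma> t) u) - exp (E0 (\<sigma> t) u)) / e t)"
  have lim: "((\<lambda>t. integral\<^sup>L lborel (?f t)) \<longlongrightarrow>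
      (\<integral>u. indicator S u * (exp (E0 \<sigma>0 u) * (- d * u + d\<^sup>2 * u ^ 3 / 6)) \<partial>lborel)) at_top"
  proof (rule integral_dominated_convergence_at_top)
    show "?f t \<in> borel_measurable lborel" for t using S by measurable
    show "(\<lambda>u. indicator S u * (exp (E0 \<sigma>0 u) * (- d * u + d\<^sup>2 * u ^ 3 / 6))) \<in> borel_measurable lborel"
      using S by measurable
    show "integrable lborel (\<lambda>u. K * (d + 6 * d\<^sup>2) * exp (- 2 * \<bar>u\<bar>))"
      by (intro integrable_mult_right integrable_exp_neg_abs) simp
    show "AE u in lborel. ((\<lambda>t. ?f t u) \<longlongrightarrow>
        indicator S u * (exp (E0 \<sigma>0 u) * (- d * u + d\<^sup>2 * u ^ 3 / 6))) at_top"
    proof (rule AE_I2)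
      fix u
      have "((\<lambda>t. (exp (E (e t) 0 u - E0 0 u) - 1) / e t) \<longlongrightarrow> - d * u + d\<^sup>2 * u ^ 3 / 6) at_top"
        by (rule filterlim_compose[OF scaled_exponent_limit e])
      moreover have "((\<lambda>t. exp (E0 (\<sigma> t) u)) \<longlongrightarrow> exp (E0 \<sigma>0 u)) at_top"
        by (intro tendsto_intros \<sigma>)
      ultimately have "((\<lambda>t. indicator S u * (exp (E0 (\<sigma> t) u) * ((exp (E (e t) 0 u - E0 0 u) - 1) / e t)))
          \<longlongrightarrow> indicator S u * (exp (E0 \<sigma>0 u) * (- d * u + d\<^sup>2 * u ^ 3 / 6))) at_top"
        by (intro tendsto_mult tendsto_const)
      moreover have "exp (E0 (\<sigma> t) u) * ((exp (E (e t) 0 u - E0 0 u) - 1) / e t)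
          = (exp (E (e t) (\<sigma> t) u) - exp (E0 (\<sigma> t) u)) / e t" for t
      proof -
        have "E (e t) (\<sigma> t) u = E0 (\<sigma> t) u + (E (e t) 0 u - E0 0 u)" by simp
        then have "exp (E (e t) (\<sigma> t) u) = exp (E0 (\<sigma> t) u) * exp (E (e t) 0 u - E0 0 u)"
          by (metis exp_add)
        then show ?thesis by (simp add: right_diff_distrib)
      qed
      ultimately show "((\<lambda>t. ?f t u) \<longlongrightarrow> indicator S u * (exp (E0 \<sigma>0 u) * (- d * u + d\<^sup>2 * u ^ 3 / 6))) at_top"
        by (simp only:)
    qed
    show "\<forall>\<^sub>F t in at_top. AE u in lborel. norm (?f t u) \<le> K * (d + 6 * d\<^sup>2) * exp (- 2 * \<bar>u\<bar>)"
      using good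
    proof eventually_elim
      case (elim t)
      show ?case
      proof (rule AE_I2)
        fix u
        let ?M = "K * exp (- 4 * \<bar>u\<bar>)"
        have "\<bar>exp (E (e t) (\<sigma> t) u) - exp (E0 (\<sigma> t) u)\<bar> \<le> \<bar>E (e t) (\<sigma> t) u - E0 (\<sigma> t) u\<bar> * ?M"
          using scaled_exponent_le[of "\<sigma> t" a k "e t" u] gauss_exponent_le[of "\<sigma> t" a k u] elim k
          by (intro abs_exp_diff_le) (simp_all add: K_def k_def)
        also have "\<dots> \<le> (e t * ((d + 6 * d\<^sup>2) * exp (2 * \<bar>u\<bar>))) * ?M"
          using elim by (intro mult_right_mono scaled_exponent_diff_le) (auto simp: K_def)
        also have "\<dots> = e t * (K * (d + 6 * d\<^sup>2) * exp (- 2 * \<bar>u\<bar>))"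
          by (simp add: algebra_simps mult_exp_exp)
        finally have "\<bar>exp (E (e t) (\<sigma> t) u) - exp (E0 (\<sigma> t) u)\<bar> / e t \<le> K * (d + 6 * d\<^sup>2) * exp (- 2 * \<bar>u\<bar>)"
          using elim by (simp add: pos_divide_le_eq mult.commute)
        moreover have "0 \<le> K * (d + 6 * d\<^sup>2) * exp (- 2 * \<bar>u\<bar>)" using d by (simp add: K_def)
        ultimately show "norm (?f t u) \<le> K * (d + 6 * d\<^sup>2) * exp (- 2 * \<bar>u\<bar>)"
          using elim by (auto split: split_indicator)
      qed
    qed
  qed
  have "eventually (\<lambda>t. integral\<^sup>L lborel (?f t)
      = (scaled_transform d S (e t) (\<sigma> t) - gauss_transform d S (\<sigma> t)) / e t) at_top"
    using good
  proof eventually_elim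
    case (elim t)
    have int: "set_integrable lborel S (\<lambda>u. exp (E (e t) (\<sigma> t) u))"
      unfolding set_integrable_def
    proof (rule Bochner_Integration.integrable_bound)
      show "integrable lborel (\<lambda>u. K * exp (- 4 * \<bar>u\<bar>))"
        by (intro integrable_mult_right integrable_exp_neg_abs) simp
      show "AE u in lborel. norm (indicator S u *\<^sub>R exp (E (e t) (\<sigma> t) u)) \<le> norm (K * exp (- 4 * \<bar>u\<bar>))"
        using scaled_exponent_le[of "\<sigma> t" a k "e t"] elim k
        by (intro AE_I2) (auto simp: K_def k_def split: split_indicator)
    qed (use S in measurable)
    have "scaled_transform d S (e t) (\<sigma> t) - gauss_transform d S (\<sigma> t)
        = (LBINT u:S. exp (E (e t) (\<sigma> t) u) - exp (E0 (\<sigma> t) u))"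
      unfolding scaled_transform_def gauss_transform_def
      using set_integral_diff(2)[OF int gauss_integrable[OF S]] by simp
    then show ?case
      by (simp add: set_lebesgue_integral_def)
  qed
  from Lim_transform_eventually[OF lim this] show ?thesis
    by (simp add: set_lebesgue_integral_def)
qed

end

section \<open>The diffusion cost\<close>

lemma std_normal_density_shift:
  "std_normal_density (t + r * u) = std_normal_density t * exp (- (r * t) * u - r\<^sup>2 * u\<^sup>2 / 2)"
  unfolding std_normal_density_def
  by (simp add: mult_exp_exp power2_eq_square field_simps)

text \<open>
  Completing the square: substitute \<open>v = t + r u\<close> in the Gaussian tail integral.
\<close>

lemma normal_tail_gauss_transform:
  assumes "0 < r"
  shows "1 - cdf std_normal_distribution t =
    r * std_normal_density t * gauss_transform (r\<^sup>2) {0<..} (r * t)"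
proof -
  interpret real_distribution std_normal_distribution by (rule real_dist_normal_dist)
  have "1 - cdf std_normal_distribution t = measure std_normal_distribution {t<..}"
  proof -
    have "measure std_normal_distribution {t<..} = 1 - measure std_normal_distribution {..t}"
      using prob_compl[of "{..t}"] by (simp add: Compl_eq_Diff_UNIV[symmetric] Compl_atMost)
    then show ?thesis by (simp add: cdf_def)
  qed
  also have "\<dots> = (\<integral>v. indicator {t<..} v * std_normal_density v \<partial>lborel)"
  proof -
    have "measure std_normal_distribution {t<..} = (\<integral>v. indicator {t<..} v \<partial>std_normal_distribution)"
      by simp
    also have "\<dots> = (\<integral>v. std_normal_density v *\<^sub>R indicator {t<..} v \<partial>lborel)"
      by (rule integral_density) auto
    finally show ?thesis by (simp add: mult.commute)
  qed
  also have "\<dots> = \<bar>r\<bar> *\<^sub>R (\<integral>u. indicator {t<..} (t + r * u) * std_normal_density (t + r * u) \<partial>lborel)"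
    using assms by (intro lborel_integral_real_affine) auto
  also have "(\<integral>u. indicator {t<..} (t + r * u) * std_normal_density (t + r * u) \<partial>lborel)
      = (\<integral>u. std_normal_density t * (indicator {0<..} u * exp (- (r * t) * u - r\<^sup>2 * u\<^sup>2 / 2)) \<partial>lborel)"
    using assms unfolding std_normal_density_shift
    by (intro Bochner_Integration.integral_cong) (auto simp: zero_less_mult_iff split: split_indicator)
  also have "\<dots> = std_normal_density t * gauss_transform (r\<^sup>2) {0<..} (r * t)"
    by (simp add: gauss_transform_def set_lebesgue_integral_def)
  finally show ?thesis using assms by simp
qed

lemma gauss_transform_pos:
  assumes "0 < d"
  shows "0 < gauss_transform d {0<..} \<sigma>"
  unfolding gauss_transform_def set_lebesgue_integral_def
  using gauss_integrable[OF assms, of "{0<..}" \<sigma>]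
  by (intro integral_pos_interval[where a = 0 and b = 1 and z = 0])
     (auto simp: set_integrable_def split: split_indicator)

lemma gauss_transform_hazard:
  assumes "0 < d"
  shows "gauss_transform d {0<..} \<sigma> = 1 / (sqrt d * normal_hazard (\<sigma> / sqrt d))"
proof -
  have "1 - cdf std_normal_distribution (\<sigma> / sqrt d)
      = sqrt d * std_normal_density (\<sigma> / sqrt d) * gauss_transform d {0<..} \<sigma>"
    using normal_tail_gauss_transform[of "sqrt d" "\<sigma> / sqrt d"] assms by simp
  then show ?thesis
    using assms by (simp add: normal_hazard_def field_simps normal_density_nonneg normal_density_pos[THEN less_imp_neq, symmetric])
qed

lemma gauss_transform_reflect: "gauss_transform d {..<0} \<sigma> = gauss_transform d {0<..} (- \<sigma>)"
proof -
  have "gauss_transform d {..<0} \<sigma> = \<bar>-1\<bar> *\<^sub>R (\<integral>u. indicator {..<0} (0 + (-1) * u) *\<^sub>R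
      exp (- \<sigma> * (0 + (-1) * u) - d * (0 + (-1) * u)\<^sup>2 / 2) \<partial>lborel)"
    unfolding gauss_transform_def set_lebesgue_integral_def
    by (rule lborel_integral_real_affine) simp
  also have "\<dots> = gauss_transform d {0<..} (- \<sigma>)"
    unfolding gauss_transform_def set_lebesgue_integral_def
    by (simp, intro Bochner_Integration.integral_cong) (auto split: split_indicator)
  finally show ?thesis .
qed

lemma normal_hazard_pos: "0 < normal_hazard t"
  using gauss_transform_pos[of 1 t] gauss_transform_hazard[of 1 t] by simp

text \<open>
  The formula of \<open>erlang_queue\<close> with both transforms replaced by their Gaussian limits.
\<close>

definition gauss_queue :: "real \<Rightarrow> real \<Rightarrow> real" where
  "gauss_queue d \<sigma> = (1 / d - \<sigma> / d * gauss_transform d {0<..} \<sigma>) /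
     (gauss_transform 1 {..<0} \<sigma> + gauss_transform d {0<..} \<sigma>)"

lemma diffusion_queue_eq_gauss_queue:
  assumes "0 < \<mu>" "0 < \<gamma>"
  shows "diffusion_queue \<mu> \<gamma> \<sigma> = gauss_queue (\<gamma> / \<mu>) \<sigma>"
proof -
  define d where "d = \<gamma> / \<mu>"
  define C where "C = gauss_transform d {0<..} \<sigma>"
  define A where "A = gauss_transform 1 {..<0} \<sigma>"
  have d: "0 < d" using assms by (simp add: d_def)
  have C: "0 < C" and A: "0 < A"
    using gauss_transform_pos d by (simp_all add: C_def A_def gauss_transform_reflect)
  have t: "\<sigma> * sqrt (\<mu> / \<gamma>) = \<sigma> / sqrt d" by (simp add: d_def real_sqrt_divide)
  have H: "sqrt d * normal_hazard (\<sigma> / sqrt d) = 1 / C"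
    using normal_hazard_pos d unfolding C_def gauss_transform_hazard[OF d] by simp
  have H1: "normal_hazard (- \<sigma>) = 1 / A"
    using normal_hazard_pos[of "- \<sigma>"] unfolding A_def gauss_transform_reflect
    by (subst gauss_transform_hazard) auto
  have "diffusion_queue \<mu> \<gamma> \<sigma> = \<mu> / \<gamma> * (sqrt d * normal_hazard (\<sigma> / sqrt d) - \<sigma>) *
      inverse (1 + sqrt d * normal_hazard (\<sigma> / sqrt d) / normal_hazard (- \<sigma>))"
    unfolding diffusion_queue_def t d_def by simp
  also have "\<dots> = 1 / d * (1 / C - \<sigma>) * inverse (1 + 1 / C / (1 / A))"
    unfolding H H1 by (simp add: d_def)
  also have "inverse (1 + 1 / C / (1 / A)) = C / (A + C)"
    using A C by (simp add: field_simps)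
  also have "1 / d * (1 / C - \<sigma>) * (C / (A + C)) = (1 / d - \<sigma> / d * C) / (A + C)"
  proof -
    have "1 / d * (1 / C - \<sigma>) * C = 1 / d - \<sigma> / d * C"
      using C d by (simp add: field_simps)
    then show ?thesis by (simp only: times_divide_eq_right)
  qed
  finally show ?thesis by (simp add: gauss_queue_def A_def C_def d_def)
qed

lemma std_normal_cdf_DERIV:
  "(cdf std_normal_distribution has_real_derivative std_normal_density t) (at t)"
proof -
  interpret real_distribution std_normal_distribution by (rule real_dist_normal_dist)
  have cont: "continuous_on S std_normal_density" for S
    unfolding std_normal_density_def by (intro continuous_intros) auto
  have eq: "cdf std_normal_distribution (t - 1) + integral {t - 1..x} std_normal_density
      = cdf std_normal_distribution x" if "t - 1 < x" for x
  proof -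
    have "cdf std_normal_distribution x - cdf std_normal_distribution (t - 1)
        = measure std_normal_distribution {t - 1<..x}"
      using that by (rule cdf_diff_eq)
    also have "\<dots> = (\<integral>v. indicator {t - 1<..x} v \<partial>std_normal_distribution)"
      by simp
    also have "\<dots> = (\<integral>v. std_normal_density v *\<^sub>R indicator {t - 1<..x} v \<partial>lborel)"
      by (rule integral_density) auto
    also have "\<dots> = (LBINT v:{t - 1..x}. std_normal_density v)"
      unfolding set_lebesgue_integral_def
      by (rule integral_cong_AE) (use AE_lborel_singleton[of "t - 1"] in
          \<open>auto elim!: eventually_mono split: split_indicator\<close>)
    also have "\<dots> = integral {t - 1..x} std_normal_density"
      by (intro set_borel_integral_eq_integral borel_integrable_atLeastAtMost' cont)
    finally show ?thesis by simp
  qed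
  have "((\<lambda>x. cdf std_normal_distribution (t - 1) + integral {t - 1..x} std_normal_density)
      has_real_derivative (0 + std_normal_density t)) (at t within {t - 1..t + 1})"
    by (intro DERIV_add DERIV_const integral_has_real_derivative cont) auto
  then have "((\<lambda>x. cdf std_normal_distribution (t - 1) + integral {t - 1..x} std_normal_density)
      has_real_derivative std_normal_density t) (at t)"
    by (simp add: at_within_Icc_at)
  then show ?thesis
  proof (rule has_field_derivative_transform_within_open[where S = "{t - 1<..}"])
    show "cdf std_normal_distribution (t - 1) + integral {t - 1..x} std_normal_density
      = cdf std_normal_distribution x" if "x \<in> {t - 1<..}" for x
      using eq that by simp
  qed auto
qed

lemma normal_hazard_differentiable: "normal_hazard differentiable (at t)"
proof -
  have "(\<lambda>x. cdf std_normal_distribution x) differentiable (at t)"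
    using std_normal_cdf_DERIV by (metis real_differentiable_def)
  moreover have "(std_normal_density has_real_derivative - t * std_normal_density t) (at t)"
  proof -
    have "((\<lambda>x. k * exp (- x\<^sup>2 / 2)) has_real_derivative - t * (k * exp (- t\<^sup>2 / 2))) (at t)" for k
      by (auto intro!: derivative_eq_intros)
    then show ?thesis unfolding std_normal_density_def .
  qed
  then have "std_normal_density differentiable (at t)"
    by (metis real_differentiable_def)
  moreover have "1 - cdf std_normal_distribution t \<noteq> 0"
    using normal_hazard_pos[of t] by (auto simp: normal_hazard_def)
  ultimately show ?thesis
    unfolding normal_hazard_def[abs_def] by (intro differentiable_divide differentiable_diff) auto
qed

lemma diffusion_cost_differentiable:
  assumes "0 < \<mu>" "0 < \<gamma>"
  shows "diffusion_cost h c \<mu> \<gamma> differentiable (at \<sigma>)"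
proof -
  have H: "(\<lambda>\<sigma>. normal_hazard (\<sigma> * k)) differentiable (at \<sigma>)" for k :: real
    by (rule differentiable_compose[OF normal_hazard_differentiable])
       (auto intro!: derivative_intros simp: real_differentiable_def)
  have Hneg: "(\<lambda>\<sigma>. normal_hazard (- \<sigma>)) differentiable (at \<sigma>)"
    using H[of "-1"] by simp
  have "0 < 1 + sqrt (\<gamma> / \<mu>) * (normal_hazard (\<sigma> * sqrt (\<mu> / \<gamma>)) / normal_hazard (- \<sigma>))"
    using assms normal_hazard_pos by (intro add_pos_pos mult_pos_pos divide_pos_pos) auto
  then show ?thesis
    unfolding diffusion_cost_def[abs_def] diffusion_queue_def
    using normal_hazard_pos[of "- \<sigma>"]
    by (intro differentiable_add differentiable_mult differentiable_diff differentiable_inverse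
        differentiable_divide H Hneg differentiable_const differentiable_ident) auto
qed

text \<open>
  Here the kernel is Gaussian on each half line and \<open>g\<close> is piecewise linear, with slopes \<open>- c\<close>
  and \<open>h - c d\<close>. Multiplication by \<open>s\<close> corresponds to multiplication by \<open>- d u\<close>, by integrating
  the derivative of the kernel.
\<close>

lemma diffusion_cost_strictly_quasiconvex:
  assumes pos: "0 < h" "0 < c" "0 < \<mu>" "0 < \<gamma>" and cheap: "c / \<mu> < h / \<gamma>"
    and s: "s1 < s3" "s3 < s2"
  shows "diffusion_cost h c \<mu> \<gamma> s3 < max (diffusion_cost h c \<mu> \<gamma> s1) (diffusion_cost h c \<mu> \<gamma> s2)"
proof -
  define d where "d = \<gamma> / \<mu>"
  have d: "0 < d" using pos by (simp add: d_def)
  have cd: "c < h / d" using cheap pos by (simp add: d_def field_simps)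
  let ?m = "\<lambda>u. if u < 0 then exp (- 1 * u\<^sup>2 / 2) else exp (- d * u\<^sup>2 / 2)"
  let ?g = "\<lambda>u. if u < 0 then - c * u else (h - c * d) * u"
  let ?G = "\<lambda>d s u. exp (- s * u - d * u\<^sup>2 / 2)"
  have split: "exp (- s * u) * exp (- d * u\<^sup>2 / 2) = ?G d s u" for s u d :: real
    by (simp add: mult_exp_exp)
  have iG: "set_integrable lborel S (?G d s)" if "0 < d" "S \<in> sets borel" for d s :: real and S
    by (rule gauss_integrable[OF that])
  have iuG: "set_integrable lborel S (\<lambda>u. u * ?G d s u)" if d: "0 < d" and S: "S \<in> sets borel" for d s :: real and S
    unfolding set_integrable_def
  proof (rule Bochner_Integration.integrable_bound)
    let ?k = "\<bar>s\<bar> + 3"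
    show "integrable lborel (\<lambda>u. exp (?k\<^sup>2 / d) * exp (- 1 * \<bar>u\<bar>))"
      by (intro integrable_mult_right integrable_exp_neg_abs) simp
    show "AE u in lborel. norm (indicator S u *\<^sub>R (u * ?G d s u)) \<le> norm (exp (?k\<^sup>2 / d) * exp (- 1 * \<bar>u\<bar>))"
    proof (rule AE_I2)
      fix u
      have "?G d s u \<le> exp (?k\<^sup>2 / d) * exp (- 2 * \<bar>u\<bar>)"
        using gauss_exponent_le[OF d, of s "\<bar>s\<bar>" ?k u] by simp
      moreover have "\<bar>u\<bar> \<le> exp \<bar>u\<bar>" using exp_ge_add_one_self[of "\<bar>u\<bar>"] by linarith
      ultimately have "\<bar>u\<bar> * ?G d s u \<le> exp \<bar>u\<bar> * (exp (?k\<^sup>2 / d) * exp (- 2 * \<bar>u\<bar>))"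
        by (intro mult_mono) auto
      also have "\<dots> = exp (?k\<^sup>2 / d) * exp (- 1 * \<bar>u\<bar>)"
        by (simp add: mult_exp_exp)
      finally show "norm (indicator S u *\<^sub>R (u * ?G d s u)) \<le> norm (exp (?k\<^sup>2 / d) * exp (- 1 * \<bar>u\<bar>))"
        by (auto simp: abs_mult split: split_indicator)
    qed
  qed (use S in measurable)
  have deriv: "((\<lambda>u. - ?G d s u) has_real_derivative s * ?G d s u + d * (u * ?G d s u)) (at u)" for d s u :: real
    by (auto intro!: derivative_eq_intros simp: algebra_simps)
  have right: "d * (LBINT u:{0<..}. u * ?G d s u) = 1 - s * gauss_transform d {0<..} s"
    if "0 < d" for d s :: real
  proof -
    have "(LBINT u:{0<..}. s * ?G d s u + d * (u * ?G d s u)) = - (- ?G d s 0)"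
    proof (rule integral_right_half_line_FTC[OF deriv])
      show "((\<lambda>u. - ?G d s u) \<longlongrightarrow> 0) at_top" using that by real_asymp
      show "set_integrable lborel {0<..} (\<lambda>u. s * ?G d s u + d * (u * ?G d s u))"
        using that by (intro set_integral_add set_integrable_mult_right iG iuG) auto
    qed (auto intro!: continuous_intros)
    moreover have "(LBINT u:{0<..}. s * ?G d s u + d * (u * ?G d s u))
        = s * gauss_transform d {0<..} s + d * (LBINT u:{0<..}. u * ?G d s u)"
      unfolding gauss_transform_def using that iG[of d "{0<..}" s] iuG[of d "{0<..}" s]
      by (subst set_integral_add) (auto intro!: set_integrable_mult_right)
    ultimately show ?thesis by simp
  qed
  have left: "(LBINT u:{..<0}. u * ?G 1 s u) = - 1 - s * gauss_transform 1 {..<0} s" for s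
  proof -
    have "(LBINT u:{..<0}. s * ?G 1 s u + 1 * (u * ?G 1 s u)) = - ?G 1 s 0"
    proof (rule integral_left_half_line_FTC[OF deriv])
      show "((\<lambda>u. - ?G 1 s u) \<longlongrightarrow> 0) at_bot" by real_asymp
      show "set_integrable lborel {..<0} (\<lambda>u. s * ?G 1 s u + 1 * (u * ?G 1 s u))"
        by (intro set_integral_add set_integrable_mult_right iG iuG) auto
    qed (auto intro!: continuous_intros)
    moreover have "(LBINT u:{..<0}. s * ?G 1 s u + 1 * (u * ?G 1 s u))
        = s * gauss_transform 1 {..<0} s + (LBINT u:{..<0}. u * ?G 1 s u)"
      unfolding gauss_transform_def using iG[of 1 "{..<0}" s] iuG[of 1 "{..<0}" s]
      by (subst set_integral_add) (auto intro!: set_integrable_mult_right)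
    ultimately show ?thesis by simp
  qed
  show ?thesis
  proof (rule tilted_mean_strictly_quasiconvex[where f = "diffusion_cost h c \<mu> \<gamma>" and m = ?m and g = ?g, OF _ s])
    show "0 < ?m y" for y by simp
    fix s
    have Z: "integrable lborel (\<lambda>u. exp (- s * u) * ?m u)"
      "(\<integral>u. exp (- s * u) * ?m u \<partial>lborel) = gauss_transform 1 {..<0} s + gauss_transform d {0<..} s"
      using integral_split_at_zero[OF iG[of 1 "{..<0}" s] iG[of d "{0<..}" s], of "\<lambda>u. exp (- s * u) * ?m u"] d
      by (auto simp: gauss_transform_def mult_exp_exp)
    then show "integrable lborel (\<lambda>u. exp (- s * u) * ?m u)" by blast
    have il: "set_integrable lborel {..<0} (\<lambda>u. - c * (u * ?G 1 s u))"
      by (intro set_integrable_mult_right iuG) auto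
    have ir: "set_integrable lborel {0<..} (\<lambda>u. (h - c * d) * (u * ?G d s u))"
      using d by (intro set_integrable_mult_right iuG) auto
    have N: "integrable lborel (\<lambda>u. ?g u * (exp (- s * u) * ?m u))"
      "(\<integral>u. ?g u * (exp (- s * u) * ?m u) \<partial>lborel)
        = (LBINT u:{..<0}. - c * (u * ?G 1 s u)) + (LBINT u:{0<..}. (h - c * d) * (u * ?G d s u))"
      by (rule integral_split_at_zero[OF il ir]; simp add: mult_exp_exp)+
    then show "integrable lborel (\<lambda>u. ?g u * (exp (- s * u) * ?m u))" by blast
    define A where "A = gauss_transform 1 {..<0} s"
    define C where "C = gauss_transform d {0<..} s"
    have AC: "0 < A + C"
      using gauss_transform_pos d by (simp add: A_def C_def gauss_transform_reflect add_pos_pos)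
    have l: "(LBINT u:{..<0}. - c * (u * ?G 1 s u)) = - c * (- 1 - s * A)"
      by (subst set_integral_mult_right) (simp only: left A_def)
    have r: "(LBINT u:{0<..}. (h - c * d) * (u * ?G d s u)) = (h / d - c) * (1 - s * C)"
    proof -
      have "(LBINT u:{0<..}. (h - c * d) * (u * ?G d s u)) = (h / d - c) * (d * (LBINT u:{0<..}. u * ?G d s u))"
        using d by (subst set_integral_mult_right) (simp add: field_simps)
      then show ?thesis by (simp only: right[OF d] C_def)
    qed
    have cost: "diffusion_cost h c \<mu> \<gamma> s * (A + C) = h * (1 / d - s / d * C) + c * s * (A + C)"
      using AC unfolding diffusion_cost_def diffusion_queue_eq_gauss_queue[OF pos(3,4)] gauss_queue_def
      by (simp add: A_def C_def d_def distrib_right)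
    show "diffusion_cost h c \<mu> \<gamma> s * (\<integral>u. exp (- s * u) * ?m u \<partial>lborel)
        = (\<integral>u. ?g u * (exp (- s * u) * ?m u) \<partial>lborel)"
      unfolding N(2) Z(2) l r A_def[symmetric] C_def[symmetric] cost using d by (simp add: field_simps)
  next
    show "?g y \<le> ?g x" if "x < y" "y < 0" for x y using that pos by simp
    have "0 < h - c * d" using cd d by (simp add: field_simps)
    then show "?g x \<le> ?g y" if "0 \<le> x" "x < y" for x y using that by simp
    have "filterlim (\<lambda>u. - c * u) at_top at_bot" using pos by real_asymp
    then show "filterlim ?g at_top at_bot"
      by (rule filterlim_mono_eventually)
         (auto intro!: eventually_mono[OF eventually_gt_at_bot[of 0]] simp: eventually_at_bot_dense)
  qed
qed

section \<open>Expansion of the cost in the square-root regime\<close>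

lemma gauss_transform_continuous:
  assumes "0 < d"
  shows "isCont (gauss_transform d {0<..}) \<sigma>"
proof -
  have "isCont normal_hazard (\<sigma> / sqrt d)"
    using normal_hazard_differentiable by (rule differentiable_imp_continuous_within)
  then have "isCont (\<lambda>\<sigma>. normal_hazard (\<sigma> / sqrt d)) \<sigma>"
    by (rule isCont_o2[rotated]) (auto intro!: continuous_intros simp: assms less_imp_neq[symmetric])
  then have "isCont (\<lambda>\<sigma>. 1 / (sqrt d * normal_hazard (\<sigma> / sqrt d))) \<sigma>"
    using assms normal_hazard_pos[of "\<sigma> / sqrt d"] by (intro continuous_intros) auto
  moreover have "gauss_transform d {0<..} = (\<lambda>\<sigma>. 1 / (sqrt d * normal_hazard (\<sigma> / sqrt d)))"
    by (rule ext) (rule gauss_transform_hazard[OF assms])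
  ultimately show ?thesis by (simp only:)
qed

lemma erlang_queue_scaled:
  assumes "0 < e" "0 < d" "R = 1 / e\<^sup>2"
  shows "erlang_queue R d (R + \<sigma> / e) =
    (1 / d - \<sigma> / d * scaled_transform d {0<..} e \<sigma>) /
      (scaled_transform 1 {..<0} e \<sigma> + scaled_transform d {0<..} e \<sigma>) / e"
proof -
  let ?A = "scaled_transform 1 {..<0} e \<sigma>" and ?C = "scaled_transform d {0<..} e \<sigma>"
  have "R / d + (R / d - (R + \<sigma> / e) / d) * (?C / e) = (1 / d - \<sigma> / d * ?C) / (e * e)"
    using assms(1,2) unfolding assms(3) by (simp add: field_simps power2_eq_square)
  moreover have "?A / e + ?C / e = (?A + ?C) / e"
    by (simp add: add_divide_distrib)
  ultimately show ?thesis
    unfolding erlang_queue_def busy_transform_scaled[OF assms(1,3)] wait_transform_scaled[OF assms]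
    using assms(1) by simp
qed

text \<open>
  The numerator of the difference is divisible by \<open>e\<close>, so that dividing by \<open>e\<close> leaves a continuous
  function of all quantities involved.
\<close>

lemma quotient_difference:
  fixes A C a b e d s :: real
  assumes "A + C \<noteq> 0" "A + e * a + (C + e * b) \<noteq> 0" "e \<noteq> 0"
  shows "(1 / d - s / d * (C + e * b)) / (A + e * a + (C + e * b)) / e - (1 / d - s / d * C) / (A + C) / e
    = (- (s / d) * b * (A + C) - (1 / d - s / d * C) * (a + b)) / ((A + e * a + (C + e * b)) * (A + C))"
proof -
  define p where "p = 1 / d"
  define q where "q = s / d"
  define Y where "Y = A + e * a + (C + e * b)"
  define X where "X = A + C"
  have "(p - q * (C + e * b)) / Y - (p - q * C) / X
      = ((p - q * (C + e * b)) * X - (p - q * C) * Y) / (Y * X)"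
    using assms by (simp add: X_def Y_def diff_frac_eq)
  also have "(p - q * (C + e * b)) * X - (p - q * C) * Y = e * (- q * b * X - (p - q * C) * (a + b))"
    by (simp add: X_def Y_def algebra_simps)
  finally have "((p - q * (C + e * b)) / Y - (p - q * C) / X) / e
      = (- q * b * X - (p - q * C) * (a + b)) / (Y * X)"
    using assms(3) by simp
  then show ?thesis by (simp add: p_def q_def X_def Y_def diff_divide_distrib)
qed

lemma erlang_queue_expansion:
  fixes e :: "real \<Rightarrow> real"
  assumes d: "0 < d" and e: "filterlim e (at_right 0) at_top"
  obtains r where "\<And>\<sigma>. (\<sigma> \<longlongrightarrow> \<sigma>0) at_top \<Longrightarrow>
    ((\<lambda>t. erlang_queue (1 / (e t)\<^sup>2) d (1 / (e t)\<^sup>2 + \<sigma> t / e t) - gauss_queue d (\<sigma> t) / e t) \<longlongrightarrow> r) at_top"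
proof -
  define cA where "cA = (LBINT u:{..<0}. exp (- \<sigma>0 * u - 1 * u\<^sup>2 / 2) * (- 1 * u + 1\<^sup>2 * u ^ 3 / 6))"
  define cC where "cC = (LBINT u:{0<..}. exp (- \<sigma>0 * u - d * u\<^sup>2 / 2) * (- d * u + d\<^sup>2 * u ^ 3 / 6))"
  define A where "A = gauss_transform 1 {..<0}"
  define C where "C = gauss_transform d {0<..}"
  have Apos: "0 < A s" and Cpos: "0 < C s" for s
    using gauss_transform_pos d by (simp_all add: A_def C_def gauss_transform_reflect)
  have contC: "isCont C s" for s
    unfolding C_def by (rule gauss_transform_continuous[OF d])
  have contA: "isCont A s" for s
    unfolding A_def gauss_transform_reflect
    by (rule isCont_o2[OF _ gauss_transform_continuous]) (auto intro!: continuous_intros)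
  define r where "r = (- (\<sigma>0 / d) * cC * (A \<sigma>0 + C \<sigma>0) - (1 / d - \<sigma>0 / d * C \<sigma>0) * (cA + cC)) /
      ((A \<sigma>0 + 0 * cA + (C \<sigma>0 + 0 * cC)) * (A \<sigma>0 + C \<sigma>0))"
  show thesis
  proof (rule that[of r])
    fix \<sigma> :: "real \<Rightarrow> real" assume \<sigma>: "(\<sigma> \<longlongrightarrow> \<sigma>0) at_top"
    define a where "a t = (scaled_transform 1 {..<0} (e t) (\<sigma> t) - A (\<sigma> t)) / e t" for t
    define b where "b t = (scaled_transform d {0<..} (e t) (\<sigma> t) - C (\<sigma> t)) / e t" for t
    have a: "(a \<longlongrightarrow> cA) at_top"
      unfolding a_def cA_def A_def by (rule scaled_transform_expansion[OF _ \<sigma> e]) auto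
    have b: "(b \<longlongrightarrow> cC) at_top"
      unfolding b_def cC_def C_def by (rule scaled_transform_expansion[OF d \<sigma> e]) auto
    have e0: "(e \<longlongrightarrow> 0) at_top" and epos: "eventually (\<lambda>t. 0 < e t) at_top"
      using e by (auto simp: filterlim_at elim: eventually_mono)
    have tA: "((\<lambda>t. A (\<sigma> t)) \<longlongrightarrow> A \<sigma>0) at_top" and tC: "((\<lambda>t. C (\<sigma> t)) \<longlongrightarrow> C \<sigma>0) at_top"
      using \<sigma> by (auto intro: isCont_tendsto_compose[OF contA] isCont_tendsto_compose[OF contC])
    have AC: "A s + C s \<noteq> 0" for s using Apos[of s] Cpos[of s] by linarith
    let ?D = "\<lambda>t. A (\<sigma> t) + e t * a t + (C (\<sigma> t) + e t * b t)"
    have D: "(?D \<longlongrightarrow> A \<sigma>0 + 0 * cA + (C \<sigma>0 + 0 * cC)) at_top"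
      by (intro tendsto_add tendsto_mult tA tC e0 a b)
    have "eventually (\<lambda>t. ?D t \<noteq> 0) at_top"
      using D AC[of \<sigma>0] by (intro tendsto_imp_eventually_ne) auto
    then have "eventually (\<lambda>t.
        (- (\<sigma> t / d) * b t * (A (\<sigma> t) + C (\<sigma> t)) - (1 / d - \<sigma> t / d * C (\<sigma> t)) * (a t + b t)) /
          (?D t * (A (\<sigma> t) + C (\<sigma> t)))
      = erlang_queue (1 / (e t)\<^sup>2) d (1 / (e t)\<^sup>2 + \<sigma> t / e t) - gauss_queue d (\<sigma> t) / e t) at_top"
      using epos
    proof eventually_elim
      case (elim t)
      have "scaled_transform 1 {..<0} (e t) (\<sigma> t) = A (\<sigma> t) + e t * a t"
        "scaled_transform d {0<..} (e t) (\<sigma> t) = C (\<sigma> t) + e t * b t"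
        using elim by (simp_all add: a_def b_def)
      then show ?case
        unfolding erlang_queue_scaled[OF elim(2) d refl] gauss_queue_def A_def[symmetric] C_def[symmetric]
        using quotient_difference[of "A (\<sigma> t)" "C (\<sigma> t)" "e t" "a t" "b t" d "\<sigma> t"] elim AC by simp
    qed
    moreover have "((\<lambda>t.
        (- (\<sigma> t / d) * b t * (A (\<sigma> t) + C (\<sigma> t)) - (1 / d - \<sigma> t / d * C (\<sigma> t)) * (a t + b t)) /
          (?D t * (A (\<sigma> t) + C (\<sigma> t)))) \<longlongrightarrow> r) at_top"
      unfolding r_def using AC[of \<sigma>0] d
      by (intro tendsto_divide tendsto_diff tendsto_mult tendsto_add tendsto_minus tendsto_const
          D \<sigma> a b tA tC e0) auto
    ultimately show "((\<lambda>t. erlang_queue (1 / (e t)\<^sup>2) d (1 / (e t)\<^sup>2 + \<sigma> t / e t) - gauss_queue d (\<sigma> t) / e t)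
        \<longlongrightarrow> r) at_top"
      by (rule Lim_transform_eventually[rotated])
  qed
qed

definition diffusion_scale :: "real \<Rightarrow> real \<Rightarrow> nat \<Rightarrow> real" where
  "diffusion_scale \<mu> lam n = (real n - lam / \<mu>) / sqrt (lam / \<mu>)"

text \<open>
  The constant \<open>r\<close> is fixed before the staffing rule \<open>n\<close>: it is common to all rules whose centred
  and scaled level has the limit \<open>\<sigma>0\<close>.
\<close>

lemma staffing_cost_expansion:
  assumes pos: "0 < \<mu>" "0 < \<gamma>"
  obtains r where "\<And>n. ((\<lambda>lam. diffusion_scale \<mu> lam (n lam)) \<longlongrightarrow> \<sigma>0) at_top \<Longrightarrow>
    ((\<lambda>lam. staffing_cost h c \<mu> \<gamma> lam (n lam) - c * (lam / \<mu>)
        - sqrt (lam / \<mu>) * diffusion_cost h c \<mu> \<gamma> (diffusion_scale \<mu> lam (n lam))) \<longlongrightarrow> r) at_top"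
proof -
  define e where "e lam = 1 / sqrt (lam / \<mu>)" for lam
  have d: "0 < \<gamma> / \<mu>" using pos by simp
  have e: "filterlim e (at_right 0) at_top"
    unfolding e_def[abs_def] using pos by real_asymp
  obtain r where r: "\<And>\<sigma>. (\<sigma> \<longlongrightarrow> \<sigma>0) at_top \<Longrightarrow>
    ((\<lambda>t. erlang_queue (1 / (e t)\<^sup>2) (\<gamma> / \<mu>) (1 / (e t)\<^sup>2 + \<sigma> t / e t) - gauss_queue (\<gamma> / \<mu>) (\<sigma> t) / e t) \<longlongrightarrow> r) at_top"
    using erlang_queue_expansion[OF d e] by blast
  show thesis
  proof (rule that[of "h * r"])
    fix n :: "real \<Rightarrow> nat"
    assume "((\<lambda>lam. diffusion_scale \<mu> lam (n lam)) \<longlongrightarrow> \<sigma>0) at_top"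
    from tendsto_mult[OF tendsto_const[of h] r[OF this]]
    show "((\<lambda>lam. staffing_cost h c \<mu> \<gamma> lam (n lam) - c * (lam / \<mu>)
        - sqrt (lam / \<mu>) * diffusion_cost h c \<mu> \<gamma> (diffusion_scale \<mu> lam (n lam))) \<longlongrightarrow> h * r) at_top"
    proof (rule Lim_transform_eventually)
      show "eventually (\<lambda>lam. h * (erlang_queue (1 / (e lam)\<^sup>2) (\<gamma> / \<mu>)
            (1 / (e lam)\<^sup>2 + diffusion_scale \<mu> lam (n lam) / e lam)
            - gauss_queue (\<gamma> / \<mu>) (diffusion_scale \<mu> lam (n lam)) / e lam)
          = staffing_cost h c \<mu> \<gamma> lam (n lam) - c * (lam / \<mu>)
            - sqrt (lam / \<mu>) * diffusion_cost h c \<mu> \<gamma> (diffusion_scale \<mu> lam (n lam))) at_top"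
        using eventually_gt_at_top[of 0]
      proof eventually_elim
        case (elim lam)
        define S where "S = sqrt (lam / \<mu>)"
        define \<sigma> where "\<sigma> = diffusion_scale \<mu> lam (n lam)"
        have S: "0 < S" "lam / \<mu> = S\<^sup>2" using elim pos by (auto simp: S_def)
        have n: "real (n lam) = S\<^sup>2 + \<sigma> * S"
          using S by (simp add: \<sigma>_def diffusion_scale_def flip: S_def)
        have "staffing_cost h c \<mu> \<gamma> lam (n lam) = h * erlang_queue (S\<^sup>2) (\<gamma> / \<mu>) (S\<^sup>2 + \<sigma> * S) + c * (S\<^sup>2 + \<sigma> * S)"
          unfolding staffing_cost_def mean_queue_eq_erlang_queue[OF elim pos] S(2) n ..
        moreover have "diffusion_cost h c \<mu> \<gamma> \<sigma> = h * gauss_queue (\<gamma> / \<mu>) \<sigma> + c * \<sigma>"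
          unfolding diffusion_cost_def diffusion_queue_eq_gauss_queue[OF pos] ..
        moreover have "1 / (e lam)\<^sup>2 = S\<^sup>2" "x / e lam = x * S" for x
          by (simp_all add: e_def S_def[symmetric] power_divide)
        ultimately show ?case
          unfolding \<sigma>_def[symmetric] S_def[symmetric]
          unfolding S(2) by (simp add: algebra_simps)
      qed
    qed
  qed
qed

lemma staffing_cost_strictly_quasiconvex:
  assumes pos: "0 < h" "0 < c" "0 < \<mu>" "0 < \<gamma>" "0 < lam" and cheap: "c / \<mu> < h / \<gamma>"
    and n: "n1 < n3" "n3 < n2"
  shows "staffing_cost h c \<mu> \<gamma> lam n3 < max (staffing_cost h c \<mu> \<gamma> lam n1) (staffing_cost h c \<mu> \<gamma> lam n2)"
proof -
  have "c < h / (\<gamma> / \<mu>)" using cheap pos by (simp add: field_simps)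
  then show ?thesis
    unfolding staffing_cost_def mean_queue_eq_erlang_queue[OF pos(5,3,4)]
    using pos n by (intro erlang_cost_strictly_quasiconvex) auto
qed

lemma diffusion_scale_rounded:
  assumes \<mu>: "0 < \<mu>"
    and near: "\<forall>\<^sub>F lam in at_top. \<bar>real (n lam) - sqrt_staffing \<mu> \<sigma> lam\<bar> \<le> 1"
  shows "\<forall>\<^sub>F lam in at_top. \<bar>sqrt (lam / \<mu>) * (diffusion_scale \<mu> lam (n lam) - \<sigma>)\<bar> \<le> 1"
    and "((\<lambda>lam. diffusion_scale \<mu> lam (n lam)) \<longlongrightarrow> \<sigma>) at_top"
proof -
  have scale: "sqrt (lam / \<mu>) * (diffusion_scale \<mu> lam (n lam) - \<sigma>) = real (n lam) - sqrt_staffing \<mu> \<sigma> lam"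
    if "0 < lam" for lam
  proof -
    have "r * ((x - y) / r - \<sigma>) = x - (y + \<sigma> * r)" if "0 < r" for r x y :: real
    proof -
      have "r * ((x - y) / r) = x - y" using that by simp
      then show ?thesis by (simp only: right_diff_distrib[of r "(x - y) / r"]) (simp add: mult.commute)
    qed
    moreover have "0 < sqrt (lam / \<mu>)" using \<mu> that by simp
    ultimately show ?thesis unfolding diffusion_scale_def sqrt_staffing_def by blast
  qed
  show bound: "\<forall>\<^sub>F lam in at_top. \<bar>sqrt (lam / \<mu>) * (diffusion_scale \<mu> lam (n lam) - \<sigma>)\<bar> \<le> 1"
    using near eventually_gt_at_top[of 0] by eventually_elim (simp only: scale)
  have "((\<lambda>lam. diffusion_scale \<mu> lam (n lam) - \<sigma>) \<longlongrightarrow> 0) at_top"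
  proof (rule Lim_null_comparison)
    show "\<forall>\<^sub>F lam in at_top. norm (diffusion_scale \<mu> lam (n lam) - \<sigma>) \<le> 1 / sqrt (lam / \<mu>)"
      using bound eventually_gt_at_top[of 0]
    proof eventually_elim
      case (elim lam)
      have "0 < sqrt (lam / \<mu>)" using \<mu> elim by simp
      then show ?case using elim(1) unfolding abs_mult by (simp add: pos_le_divide_eq mult.commute)
    qed
    show "((\<lambda>lam. 1 / sqrt (lam / \<mu>)) \<longlongrightarrow> 0) at_top" using \<mu> by real_asymp
  qed
  then show "((\<lambda>lam. diffusion_scale \<mu> lam (n lam)) \<longlongrightarrow> \<sigma>) at_top"
    by (simp add: LIM_zero_iff)
qed

lemma eventually_floor_sqrt_staffing:
  assumes "0 < \<mu>"
  shows "\<forall>\<^sub>F lam in at_top. \<bar>real (nat \<lfloor>sqrt_staffing \<mu> \<sigma> lam\<rfloor>) - sqrt_staffing \<mu> \<sigma> lam\<bar> \<le> 1"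
proof -
  have "filterlim (\<lambda>lam. sqrt_staffing \<mu> \<sigma> lam) at_top at_top"
    unfolding sqrt_staffing_def using assms by real_asymp
  then have "\<forall>\<^sub>F lam in at_top. 0 \<le> sqrt_staffing \<mu> \<sigma> lam"
    by (simp add: filterlim_at_top)
  then show ?thesis
    by eventually_elim linarith
qed

section \<open>Asymptotic optimality\<close>

theorem mainTheorem2:
  fixes h c \<mu> \<gamma> \<sigma>_star :: real and s :: "real \<Rightarrow> nat"
  assumes "0 < h" "0 < c" "0 < \<mu>" "0 < \<gamma>"
    and "h / \<gamma> > c / \<mu>"
    and "\<forall>\<sigma>. diffusion_cost h c \<mu> \<gamma> \<sigma>_star \<le> diffusion_cost h c \<mu> \<gamma> \<sigma>"
    and "\<forall>\<^sub>F lam in at_top. int (s lam) = \<lfloor>sqrt_staffing \<mu> \<sigma>_star lam\<rfloor> \<or>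
                            int (s lam) = \<lceil>sqrt_staffing \<mu> \<sigma>_star lam\<rceil>"
  shows "((\<lambda>lam. staffing_cost h c \<mu> \<gamma> lam (s lam) - min_cost h c \<mu> \<gamma> lam) \<longlongrightarrow> 0) at_top"
proof -
  note pos = assms(1-4) and cheap = assms(5)
  define cost where "cost = staffing_cost h c \<mu> \<gamma>"
  define f where "f = diffusion_cost h c \<mu> \<gamma>"
  define S where "S lam = sqrt (lam / \<mu>)" for lam
  define z where "z = diffusion_scale \<mu>"
  define rest where "rest lam n = cost lam n - c * (lam / \<mu>) - S lam * f (z lam n)" for lam n
  have fmin: "f \<sigma>_star \<le> f \<sigma>" for \<sigma> using assms(6) by (simp add: f_def)
  have unique: "f \<sigma>_star < f \<sigma>" if "\<sigma> \<noteq> \<sigma>_star" for \<sigma>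
  proof -
    let ?mid = "(\<sigma> + \<sigma>_star) / 2"
    have "f ?mid < max (f (min \<sigma> \<sigma>_star)) (f (max \<sigma> \<sigma>_star))"
      unfolding f_def
      by (rule diffusion_cost_strictly_quasiconvex[OF pos cheap]) (use that in \<open>auto simp: min_def max_def\<close>)
    then show ?thesis using fmin[of ?mid] by (auto simp: min_def max_def split: if_splits)
  qed
  have S: "filterlim S at_top at_top"
    unfolding S_def using pos by real_asymp
  have near: "\<forall>\<^sub>F lam in at_top. \<bar>real (s lam) - sqrt_staffing \<mu> \<sigma>_star lam\<bar> \<le> 1"
    using assms(7) by eventually_elim linarith
  note zs = diffusion_scale_rounded[OF pos(3) near, folded z_def S_def]
  have fcont: "isCont f \<sigma>" for \<sigma>
    unfolding f_def using diffusion_cost_differentiable[OF pos(3,4)]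
    by (rule differentiable_imp_continuous_within)
  have expansion: "\<exists>r. \<forall>n. ((\<lambda>lam. z lam (n lam)) \<longlongrightarrow> \<sigma>) at_top \<longrightarrow>
      ((\<lambda>lam. rest lam (n lam)) \<longlongrightarrow> r) at_top" for \<sigma>
    unfolding rest_def cost_def S_def f_def z_def
    by (rule staffing_cost_expansion[OF pos(3,4), of \<sigma> h c]) blast
  \<comment> \<open>Away from the minimiser the term of order \<open>sqrt R\<close> dominates the bounded remainders.\<close>
  have cmp: "\<forall>\<^sub>F lam in at_top. cost lam (s lam) < cost lam (m lam)"
    if m: "((\<lambda>lam. z lam (m lam)) \<longlongrightarrow> \<sigma>) at_top" and "\<sigma> \<noteq> \<sigma>_star" for m \<sigma>
  proof -
    obtain r0 where r0: "((\<lambda>lam. rest lam (s lam)) \<longlongrightarrow> r0) at_top"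
      using expansion zs(2) by blast
    obtain r1 where r1: "((\<lambda>lam. rest lam (m lam)) \<longlongrightarrow> r1) at_top"
      using expansion m by blast
    have "((\<lambda>lam. f (z lam (m lam)) - f (z lam (s lam))) \<longlongrightarrow> f \<sigma> - f \<sigma>_star) at_top"
      using m zs(2) by (intro tendsto_diff isCont_tendsto_compose[OF fcont])
    then have "filterlim (\<lambda>lam. (f (z lam (m lam)) - f (z lam (s lam))) * S lam) at_top at_top"
      using unique[OF that(2)] S by (intro filterlim_tendsto_pos_mult_at_top) auto
    then have "filterlim (\<lambda>lam. (rest lam (m lam) - rest lam (s lam))
        + (f (z lam (m lam)) - f (z lam (s lam))) * S lam) at_top at_top"
      by (rule filterlim_tendsto_add_at_top[OF tendsto_diff[OF r1 r0]])
    then have "\<forall>\<^sub>F lam in at_top. 0 < (rest lam (m lam) - rest lam (s lam))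
        + (f (z lam (m lam)) - f (z lam (s lam))) * S lam"
      by (simp add: filterlim_at_top_dense)
    then show ?thesis
      by eventually_elim (simp add: rest_def algebra_simps)
  qed
  define opt where "opt lam = (SOME n. min_cost h c \<mu> \<gamma> lam = cost lam n \<and> (\<forall>n'. cost lam n \<le> cost lam n'))" for lam
  have opt: "min_cost h c \<mu> \<gamma> lam = cost lam (opt lam)" "cost lam (opt lam) \<le> cost lam n" for lam n
    using someI_ex[OF min_cost_attained[OF pos(1,2), of \<mu> \<gamma> lam]]
    unfolding opt_def cost_def by blast+
  have quasi: "cost lam n3 < max (cost lam n1) (cost lam n2)" if "0 < lam" "n1 < n3" "n3 < n2" for lam n1 n2 n3
    unfolding cost_def using staffing_cost_strictly_quasiconvex[OF pos that(1) cheap that(2,3)] .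
  have zmono: "z lam m < z lam n \<longleftrightarrow> m < n" if "0 < lam" for lam m n
  proof -
    have "x / r < y / r \<longleftrightarrow> x < y" if "0 < r" for r x y :: real
      using that by (simp add: divide_less_cancel)
    moreover have "0 < sqrt (lam / \<mu>)" using that pos by simp
    ultimately show ?thesis by (simp add: z_def diffusion_scale_def)
  qed
  define probe where "probe \<sigma> lam = nat \<lfloor>sqrt_staffing \<mu> \<sigma> lam\<rfloor>" for \<sigma> lam
  have probe: "((\<lambda>lam. z lam (probe \<sigma> lam)) \<longlongrightarrow> \<sigma>) at_top" for \<sigma>
    unfolding z_def probe_def
    by (rule diffusion_scale_rounded(2)[OF pos(3) eventually_floor_sqrt_staffing[OF pos(3)]])
  \<comment> \<open>A probe between the optimal and the rounded level would cost less than the maximum of the two,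
    yet at a limit other than \<open>\<sigma>_star\<close> it costs more than both.\<close>
  have z_opt: "((\<lambda>lam. z lam (opt lam)) \<longlongrightarrow> \<sigma>_star) at_top"
  proof (rule order_tendstoI)
    fix a assume "a < \<sigma>_star"
    define \<sigma> where "\<sigma> = (a + \<sigma>_star) / 2"
    have \<sigma>: "a < \<sigma>" "\<sigma> < \<sigma>_star" using \<open>a < \<sigma>_star\<close> by (auto simp: \<sigma>_def)
    have "\<forall>\<^sub>F lam in at_top. a < z lam (probe \<sigma> lam)"
      using order_tendstoD(1)[OF probe \<sigma>(1)] .
    moreover have "\<forall>\<^sub>F lam in at_top. 0 < z lam (s lam) - z lam (probe \<sigma> lam)"
      by (rule order_tendstoD(1)[OF tendsto_diff[OF zs(2) probe]]) (use \<sigma> in simp)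
    moreover have "\<forall>\<^sub>F lam in at_top. cost lam (s lam) < cost lam (probe \<sigma> lam)"
      using \<sigma> by (intro cmp[OF probe]) simp
    ultimately show "\<forall>\<^sub>F lam in at_top. a < z lam (opt lam)"
      using eventually_gt_at_top[of 0]
    proof eventually_elim
      case (elim lam)
      have "probe \<sigma> lam < s lam" using zmono[OF elim(4)] elim(2) by simp
      then have "\<not> opt lam < probe \<sigma> lam"
        using quasi[OF elim(4), of "opt lam" "probe \<sigma> lam" "s lam"] opt(2)[of lam "s lam"] elim(3) by auto
      moreover have "opt lam \<noteq> probe \<sigma> lam"
        using opt(2)[of lam "s lam"] elim(3) by auto
      ultimately show ?case using zmono[OF elim(4), of "probe \<sigma> lam" "opt lam"] elim(1) by simp
    qed
  next
    fix a assume "\<sigma>_star < a"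
    define \<sigma> where "\<sigma> = (a + \<sigma>_star) / 2"
    have \<sigma>: "\<sigma> < a" "\<sigma>_star < \<sigma>" using \<open>\<sigma>_star < a\<close> by (auto simp: \<sigma>_def)
    have "\<forall>\<^sub>F lam in at_top. z lam (probe \<sigma> lam) < a"
      using order_tendstoD(2)[OF probe \<sigma>(1)] .
    moreover have "\<forall>\<^sub>F lam in at_top. 0 < z lam (probe \<sigma> lam) - z lam (s lam)"
      by (rule order_tendstoD(1)[OF tendsto_diff[OF probe zs(2)]]) (use \<sigma> in simp)
    moreover have "\<forall>\<^sub>F lam in at_top. cost lam (s lam) < cost lam (probe \<sigma> lam)"
      using \<sigma> by (intro cmp[OF probe]) simp
    ultimately show "\<forall>\<^sub>F lam in at_top. z lam (opt lam) < a"
      using eventually_gt_at_top[of 0]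
    proof eventually_elim
      case (elim lam)
      have "s lam < probe \<sigma> lam" using zmono[OF elim(4)] elim(2) by simp
      then have "\<not> probe \<sigma> lam < opt lam"
        using quasi[OF elim(4), of "s lam" "probe \<sigma> lam" "opt lam"] opt(2)[of lam "s lam"] elim(3) by auto
      moreover have "opt lam \<noteq> probe \<sigma> lam"
        using opt(2)[of lam "s lam"] elim(3) by auto
      ultimately show ?case using zmono[OF elim(4), of "opt lam" "probe \<sigma> lam"] elim(1) by simp
    qed
  qed
  have "((\<lambda>lam. rest lam (s lam) - rest lam (opt lam)) \<longlongrightarrow> 0) at_top"
  proof -
    obtain r where "((\<lambda>lam. rest lam (s lam)) \<longlongrightarrow> r) at_top" "((\<lambda>lam. rest lam (opt lam)) \<longlongrightarrow> r) at_top"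
      using expansion[of \<sigma>_star] zs(2) z_opt by blast
    from tendsto_diff[OF this] show ?thesis by simp
  qed
  moreover have "((\<lambda>lam. S lam * (f (z lam (s lam)) - f \<sigma>_star)) \<longlongrightarrow> 0) at_top"
  proof -
    obtain D where D: "(f has_real_derivative D) (at \<sigma>_star)"
      using diffusion_cost_differentiable[OF pos(3,4)] unfolding f_def real_differentiable_def by blast
    \<comment> \<open>The derivative at the minimiser vanishes; the Caratheodory form \<open>f x - f \<sigma>_star = g x * (x - \<sigma>_star)\<close>
      with \<open>g\<close> continuous and \<open>g \<sigma>_star = 0\<close> absorbs the factor \<open>sqrt R\<close>.\<close>
    have "D = 0" by (rule DERIV_local_min[OF D, of 1]) (use fmin in auto)
    with D obtain g where g: "\<And>x. f x - f \<sigma>_star = g x * (x - \<sigma>_star)" "isCont g \<sigma>_star" "g \<sigma>_star = 0"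
      unfolding CARAT_DERIV by metis
    have "((\<lambda>lam. \<bar>g (z lam (s lam))\<bar>) \<longlongrightarrow> 0) at_top"
      using tendsto_rabs[OF isCont_tendsto_compose[OF g(2) zs(2)]] g(3) by simp
    then show ?thesis
    proof (rule Lim_null_comparison[rotated])
      show "\<forall>\<^sub>F lam in at_top. norm (S lam * (f (z lam (s lam)) - f \<sigma>_star)) \<le> \<bar>g (z lam (s lam))\<bar>"
        using zs(1)
      proof eventually_elim
        case (elim lam)
        have "norm (S lam * (f (z lam (s lam)) - f \<sigma>_star))
            = \<bar>g (z lam (s lam))\<bar> * \<bar>S lam * (z lam (s lam) - \<sigma>_star)\<bar>"
          unfolding g(1) by (simp add: abs_mult)
        also have "\<dots> \<le> \<bar>g (z lam (s lam))\<bar> * 1"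
          using elim by (intro mult_left_mono) auto
        finally show ?case by simp
      qed
    qed
  qed
  ultimately have upper: "((\<lambda>lam. S lam * (f (z lam (s lam)) - f \<sigma>_star)
      + (rest lam (s lam) - rest lam (opt lam))) \<longlongrightarrow> 0) at_top"
    using tendsto_add by fastforce
  have "((\<lambda>lam. cost lam (s lam) - cost lam (opt lam)) \<longlongrightarrow> 0) at_top"
  proof (rule tendsto_sandwich[OF _ _ tendsto_const upper])
    show "\<forall>\<^sub>F lam in at_top. 0 \<le> cost lam (s lam) - cost lam (opt lam)"
      using opt(2) by (intro always_eventually) simp
    show "\<forall>\<^sub>F lam in at_top. cost lam (s lam) - cost lam (opt lam)
        \<le> S lam * (f (z lam (s lam)) - f \<sigma>_star) + (rest lam (s lam) - rest lam (opt lam))"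
      using eventually_gt_at_top[of 0]
    proof eventually_elim
      case (elim lam)
      have "S lam * f \<sigma>_star \<le> S lam * f (z lam (opt lam))"
        using fmin elim pos by (intro mult_left_mono) (auto simp: S_def)
      then show ?case by (simp add: rest_def algebra_simps)
    qed
  qed
  then show ?thesis by (simp add: opt(1) cost_def)
qed

end
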